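(* Let $(A(n))_{n\in\mathbb{Z}}$ be a stationary and ergodic sequence of random matrices with values in $(\mathbb{R}\cup\{-\infty\})^{d\times d}$, such that $A(0)$ almost surely has at least one finite entry on each row, and such that the positive part of $\max_{ij}A_{ij}(0)$ is integrable. Let $x(n,0)=A(n-1)\cdots A(0)\,0$ and $y(n,0)=A(-1)\cdots A(-n)\,0$ (max-plus products, applied to the zero vector). 1. If the limit of $\left(\frac1n y(n,0)\right)_{n\in\mathbb{N}}$ is deterministic (i.e. this sequence converges almost surely to a deterministic limit), then $$\forall i\in\{1,\dots,d\},\quad \lim_n \frac1n y_i(n,0)=\max_{i\to c}\gamma^{(c)}\quad\text{a.s.},$$ the maximum being over all strongly connected components $c$ of $\mathcal{G}(A)$ reachable from $i$. In that case, for every strongly connected component $c$ of $\mathcal{G}(A)$, the submatrix $A^{\{c\}}$ of $A(0)$ whose indices are in $\{c\}$ almost surely has at least one finite entry on each row. 2. If $\left(\frac1n x(n,0)\right)_{n\in\mathbb{N}}$ converges almost surely, then its limit is deterministic and is equal to that of $\left(\frac1n y(n,0)\right)_{n\in\mathbb{N}}$, that is $$\forall i\in\{1,\dots,d\},\quad \lim_n \frac1n x_i(n,0)=\max_{i\to c}\gamma^{(c)}\quad\text{a.s.}$$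
   Context: Max-plus conventions: for matrices and vectors with entries in $\mathbb{R}\cup\{-\infty\}$, products are max-plus products: $(AB)_{ij}=\max_k(A_{ik}+B_{kj})$ and $(Ax)_i=\max_j(A_{ij}+x_j)$. "Finite" means $\neq-\infty$. $0$ denotes also the vector with all coordinates equal to $0$ (of the appropriate size). Limits are coordinatewise, with values in $\mathbb{R}\cup\{-\infty\}$. Maximal Lyapunov exponent: if $(M(n))$ is a stationary ergodic sequence of random square matrices with entries in $\mathbb{R}\cup\{-\infty\}$ (rows without finite entries allowed) such that the positive part of $\max_{ij}M_{ij}(0)$ is integrable, then by Kingman's theorem $\frac1n\max_{ij}(M(n-1)\cdots M(0))_{ij}$ and (for a two-sided sequence) $\frac1n\max_{ij}(M(-1)\cdots M(-n))_{ij}$ converge almost surely to the same constant $\gamma(M)\in\mathbb{R}\cup\{-\infty\}$, called the maximal Lyapunov exponent. Graph: $\mathcal{G}(A)$ is the directed graph with nodes $1,\dots,d$ and arcs the pairs $(i,j)$ such that $\mathbb{P}(A_{ij}(0)\neq-\infty)>0$. Strongly connected components (s.c.c.) are taken in this graph; a node that lies on no circuit forms by itself an s.c.c., called trivial. For an s.c.c. $c$, $A^{(c)}(n)=(A_{ij}(n))_{i,j\in c}$ and $\gamma^{(c)}=\gamma(A^{(c)})$ (so $\gamma^{(c)}=-\infty$ if $c$ is trivial). An s.c.c. $\tilde c$ is reachable from an s.c.c. $c$ (resp. from a node $i$), written $c\to\tilde c$ (resp. $i\to\tilde c$), if $c=\tilde c$ (resp. $i\in\tilde c$) or there is a path in $\mathcal{G}(A)$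 from a node of $c$ (resp. from $i$) to a node of $\tilde c$; $c\to i$ means that $i\in c$ or there is a path from a node of $c$ to $i$. For an s.c.c. $c$, the set $\{c\}$ of nodes is defined by $$\{c\}:=\left\{i\in\{1,\dots,d\}\;:\;\exists\,\tilde c,\ c\to i\to\tilde c,\ \gamma^{(\tilde c)}=\max_{c\to\bar c}\gamma^{(\bar c)}\right\},$$ where $\tilde c,\bar c$ range over s.c.c.'s; and $A^{\{c\}}=(A_{ij}(0))_{i,j\in\{c\}}$. *)

theory Defs
  imports "HOL-Probability.Probability" "Graph_Theory.Digraph_Component"
begin

text \<open>
  Elements of \<open>\<real> \<union> {-\<infinity>}\<close> are values of type \<^typ>\<open>ereal\<close> different from \<open>\<infinity>\<close>. The type variable
  \<open>'d\<close> is the index set \<open>{1,\<dots>,d}\<close>. Operations on matrices carry an explicit (finite, nonempty)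
  index set \<open>S\<close>, so that the submatrix of \<open>X\<close> indexed by \<open>S\<close> is just \<open>X\<close> used with index set \<open>S\<close>.
\<close>

type_synonym 'd mp_vec = "'d \<Rightarrow> ereal"
type_synonym 'd mp_mat = "'d \<Rightarrow> 'd \<Rightarrow> ereal"

definition mp_one :: "'d mp_mat" where
  "mp_one i j = (if i = j then 0 else -\<infinity>)"

definition mp_mult :: "'d set \<Rightarrow> 'd mp_mat \<Rightarrow> 'd mp_mat \<Rightarrow> 'd mp_mat" where
  "mp_mult S X Y i j = Max ((\<lambda>k. X i k + Y k j) ` S)"

definition mp_apply :: "'d set \<Rightarrow> 'd mp_mat \<Rightarrow> 'd mp_vec \<Rightarrow> 'd mp_vec" where
  "mp_apply S X v i = Max ((\<lambda>j. X i j + v j) ` S)"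

definition max_entry :: "'d set \<Rightarrow> 'd mp_mat \<Rightarrow> ereal" where
  "max_entry S X = Max ((\<lambda>(i, j). X i j) ` (S \<times> S))"

text \<open>\<open>forward_prod S X n\<close> is \<open>X(n-1) \<cdots> X(0)\<close>; \<open>backward_prod S X n\<close> is \<open>X(-1) \<cdots> X(-n)\<close>.\<close>

primrec forward_prod :: "'d set \<Rightarrow> (int \<Rightarrow> 'd mp_mat) \<Rightarrow> nat \<Rightarrow> 'd mp_mat" where
  "forward_prod S X 0 = mp_one"
| "forward_prod S X (Suc n) = mp_mult S (X (int n)) (forward_prod S X n)"

primrec backward_prod :: "'d set \<Rightarrow> (int \<Rightarrow> 'd mp_mat) \<Rightarrow> nat \<Rightarrow> 'd mp_mat" where
  "backward_prod S X 0 = mp_one"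
| "backward_prod S X (Suc n) = mp_mult S (backward_prod S X n) (X (- int (Suc n)))"

definition x_vec :: "(int \<Rightarrow> 'w \<Rightarrow> 'd mp_mat) \<Rightarrow> 'd mp_vec \<Rightarrow> nat \<Rightarrow> 'w \<Rightarrow> 'd mp_vec" where
  "x_vec A v n \<omega> = mp_apply UNIV (forward_prod UNIV (\<lambda>k. A k \<omega>) n) v"

definition y_vec :: "(int \<Rightarrow> 'w \<Rightarrow> 'd mp_mat) \<Rightarrow> 'd mp_vec \<Rightarrow> nat \<Rightarrow> 'w \<Rightarrow> 'd mp_vec" where
  "y_vec A v n \<omega> = mp_apply UNIV (backward_prod UNIV (\<lambda>k. A k \<omega>) n) v"

text \<open>Stationarity and ergodicity refer to the shift on the space of two-sided trajectories,
  equipped with the product \<open>\<sigma>\<close>-algebra.\<close>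

abbreviation path_space :: "(int \<Rightarrow> 'e::topological_space) measure" where
  "path_space \<equiv> PiM UNIV (\<lambda>_. borel)"

definition stationary :: "'w measure \<Rightarrow> (int \<Rightarrow> 'w \<Rightarrow> 'e::topological_space) \<Rightarrow> bool" where
  "stationary M X \<longleftrightarrow>
     (\<forall>n. X n \<in> borel_measurable M) \<and>
     distr M path_space (\<lambda>\<omega> n. X (n + 1) \<omega>) = distr M path_space (\<lambda>\<omega> n. X n \<omega>)"

definition ergodic :: "'w measure \<Rightarrow> (int \<Rightarrow> 'w \<Rightarrow> 'e::topological_space) \<Rightarrow> bool" where
  "ergodic M X \<longleftrightarrow>
     (\<forall>B \<in> sets path_space. (\<lambda>s n. s (n + 1)) -` B = B \<longrightarrow>
        measure M {\<omega> \<in> space M. (\<lambda>n. X n \<omega>) \<in> B} \<in> {0, 1})"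

text \<open>The definite description in \<open>lyapunov\<close> denotes the almost sure limit, which exists by
  Kingman's theorem when \<open>A\<close> is stationary and ergodic and the positive part of
  \<open>max_entry S (A 0 \<omega>)\<close> is integrable.\<close>

definition has_lyapunov ::
    "'w measure \<Rightarrow> 'd set \<Rightarrow> (int \<Rightarrow> 'w \<Rightarrow> 'd mp_mat) \<Rightarrow> ereal \<Rightarrow> bool" where
  "has_lyapunov M S A g \<longleftrightarrow> g \<noteq> \<infinity> \<and>
     (AE \<omega> in M. (\<lambda>n. max_entry S (forward_prod S (\<lambda>k. A k \<omega>) n) / ereal (real n)) \<longlonglongrightarrow> g) \<and>
     (AE \<omega> in M. (\<lambda>n. max_entry S (backward_prod S (\<lambda>k. A k \<omega>) n) / ereal (real n)) \<longlonglongrightarrow> g)"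

definition lyapunov :: "'w measure \<Rightarrow> (int \<Rightarrow> 'w \<Rightarrow> 'd mp_mat) \<Rightarrow> 'd set \<Rightarrow> ereal" where
  "lyapunov M A S = (THE g. has_lyapunov M S A g)"

definition mp_graph :: "'w measure \<Rightarrow> (int \<Rightarrow> 'w \<Rightarrow> 'd mp_mat) \<Rightarrow> ('d, 'd \<times> 'd) pre_digraph" where
  "mp_graph M A =
     \<lparr> verts = UNIV,
       arcs = {(i, j). measure M {\<omega> \<in> space M. A 0 \<omega> i j \<noteq> -\<infinity>} > 0},
       tail = fst, head = snd \<rparr>"

text \<open>Strongly connected components are identified with their sets of nodes. A node without circuit
  forms a component of its own, since \<open>reachable\<close> is reflexive on the nodes; for the same
  reason the two predicates below include the cases \<open>c = c'\<close> and \<open>i \<in> c'\<close>.\<close>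

abbreviation comps :: "'w measure \<Rightarrow> (int \<Rightarrow> 'w \<Rightarrow> 'd mp_mat) \<Rightarrow> 'd set set" where
  "comps M A \<equiv> pre_digraph.sccs_verts (mp_graph M A)"

definition node_to_comp ::
    "'w measure \<Rightarrow> (int \<Rightarrow> 'w \<Rightarrow> 'd mp_mat) \<Rightarrow> 'd \<Rightarrow> 'd set \<Rightarrow> bool" where
  "node_to_comp M A i c \<longleftrightarrow> (\<exists>j\<in>c. reachable (mp_graph M A) i j)"

definition comp_to_node ::
    "'w measure \<Rightarrow> (int \<Rightarrow> 'w \<Rightarrow> 'd mp_mat) \<Rightarrow> 'd set \<Rightarrow> 'd \<Rightarrow> bool" where
  "comp_to_node M A c i \<longleftrightarrow> (\<exists>j\<in>c. reachable (mp_graph M A) j i)"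

definition comp_to_comp ::
    "'w measure \<Rightarrow> (int \<Rightarrow> 'w \<Rightarrow> 'd mp_mat) \<Rightarrow> 'd set \<Rightarrow> 'd set \<Rightarrow> bool" where
  "comp_to_comp M A c c' \<longleftrightarrow> (\<exists>i\<in>c. \<exists>j\<in>c'. reachable (mp_graph M A) i j)"

definition max_exponent :: "'w measure \<Rightarrow> (int \<Rightarrow> 'w \<Rightarrow> 'd mp_mat) \<Rightarrow> 'd \<Rightarrow> ereal" where
  "max_exponent M A i = Max (lyapunov M A ` {c \<in> comps M A. node_to_comp M A i c})"

text \<open>The set of nodes written \<open>{c}\<close> in the literature.\<close>

definition dominant_nodes ::
    "'w measure \<Rightarrow> (int \<Rightarrow> 'w \<Rightarrow> 'd mp_mat) \<Rightarrow> 'd set \<Rightarrow> 'd set" where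
  "dominant_nodes M A c =
     {i. \<exists>c' \<in> comps M A. comp_to_node M A c i \<and> node_to_comp M A i c' \<and>
          lyapunov M A c' = Max (lyapunov M A ` {b \<in> comps M A. comp_to_comp M A c b})}"

end

theory Submission
  imports Defs
begin

text \<open>
  The products \<open>A(-1) \<cdots> A(-n)\<close> are a subadditive cocycle over the inverse shift, and
  \<open>A(n-1) \<cdots> A(0)\<close> is its value at the \<open>n\<close>-th shift of the trajectory. Kingman's theorem comes
  from a greedy decomposition of orbits, which also bounds the weight of all segments of an orbit
  uniformly; hence the exponent of a block triangular matrix is the largest exponent of its blocks,
  and \<open>limsup y\<^sub>i/n \<le> max {\<gamma>\<^sup>c | i \<rightarrow> c}\<close>. Conversely a deterministic limit \<open>L\<close> is monotone along the
  arcs of the graph and \<open>max L \<ge> \<gamma>\<^sup>c\<close> on each component \<open>c\<close>, so that \<open>L\<^sub>i \<ge> max {\<gamma>\<^sup>c | i \<rightarrow> c}\<close>. If a row of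
  the dominant submatrix could be \<open>-\<infinity>\<close>, then \<open>y\<^sub>i\<close> would grow at the rate of a node outside \<open>{c}\<close>,
  which is strictly smaller. For \<open>x\<close>, the liminf of \<open>x\<^sub>i/n\<close> is deterministic by ergodicity.
  If \<open>x\<^sub>i/n\<close> converges, then \<open>y\<^sub>i/n\<close> is close to the limit or above it for a set of times
  of density close to 1, and \<open>y\<^sub>i\<close> increases by at most a Birkhoff sum of an integrable function
  between such times, which gives the lower bound for \<open>liminf y\<^sub>i/n\<close>.
\<close>

section \<open>Linear growth rates\<close>

text \<open>For each fixed n the vectors x(n,0) and y(n,0) have the same law, but this alone does
  not transfer almost sure limits. Passing from n to n + 1 extends the paths behind y(n,0) at their
  far end, while it puts a new first arc in front of the paths behind x(n,0). Hence the increments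
  of y_i in n are bounded above by an integrable quantity, whereas for x_i it is the effect of
  shifting the trajectory that is bounded above; the second part of the theorem plays one property
  against the other. Equality of the forward and backward exponents rests on the same time reversal.
  The uniform bound over segments is forced by the block structure: an optimal path passes from one
  block to the next at a time that depends on n, so pieces with arbitrary starting time must be
  controlled on one trajectory. Rates are compared through linear bounds \<open>b * real n\<close>
  with real \<open>b\<close>, which keeps infinite rates out of the arithmetic.\<close>

lemma tendsto_div_real_iff:
  fixes u :: "nat \<Rightarrow> ereal" and g :: ereal
  shows "(\<lambda>n. u n / ereal (real n)) \<longlonglongrightarrow> g \<longleftrightarrow>
    (\<forall>b. ereal b < g \<longrightarrow> (\<forall>\<^sub>F n in sequentially. ereal (b * real n) \<le> u n)) \<and>
    (\<forall>b. g < ereal b \<longrightarrow> (\<forall>\<^sub>F n in sequentially. u n \<le> ereal (b * real n)))"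
    (is "?L \<longleftrightarrow> ?R")
proof
  assume L: ?L
  show ?R
  proof (intro conjI allI impI)
    fix b assume "ereal b < g"
    with L have "\<forall>\<^sub>F n in sequentially. ereal b < u n / ereal (real n)"
      by (rule order_tendstoD)
    moreover have "\<forall>\<^sub>F n in sequentially. n > (0::nat)" by (rule eventually_gt_at_top)
    ultimately show "\<forall>\<^sub>F n in sequentially. ereal (b * real n) \<le> u n"
    proof eventually_elim
      case (elim n)
      then have "ereal b * ereal (real n) < u n" by (subst (asm) ereal_less_divide_pos) (auto simp: mult.commute)
      then show ?case by simp
    qed
  next
    fix b assume "g < ereal b"
    with L have "\<forall>\<^sub>F n in sequentially. u n / ereal (real n) < ereal b"
      by (rule order_tendstoD)
    moreover have "\<forall>\<^sub>F n in sequentially. n > (0::nat)" by (rule eventually_gt_at_top)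
    ultimately show "\<forall>\<^sub>F n in sequentially. u n \<le> ereal (b * real n)"
    proof eventually_elim
      case (elim n)
      then have "u n < ereal b * ereal (real n)" by (subst (asm) ereal_divide_less_pos) (auto simp: mult.commute)
      then show ?case by simp
    qed
  qed
next
  assume R: ?R
  show ?L
  proof (rule order_tendstoI)
    fix a assume "a < g"
    then obtain b where b: "a < ereal b" "ereal b < g" using ereal_dense2 by blast
    with R have "\<forall>\<^sub>F n in sequentially. ereal (b * real n) \<le> u n" by blast
    moreover have "\<forall>\<^sub>F n in sequentially. n > (0::nat)" by (rule eventually_gt_at_top)
    ultimately show "\<forall>\<^sub>F n in sequentially. a < u n / ereal (real n)"
    proof eventually_elim
      case (elim n)
      then have "ereal b \<le> u n / ereal (real n)"
        by (subst ereal_le_divide_pos) (auto simp: mult.commute)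
      with b show ?case by auto
    qed
  next
    fix a assume "g < a"
    then obtain b where b: "g < ereal b" "ereal b < a" using ereal_dense2 by blast
    with R have "\<forall>\<^sub>F n in sequentially. u n \<le> ereal (b * real n)" by blast
    moreover have "\<forall>\<^sub>F n in sequentially. n > (0::nat)" by (rule eventually_gt_at_top)
    ultimately show "\<forall>\<^sub>F n in sequentially. u n / ereal (real n) < a"
    proof eventually_elim
      case (elim n)
      then have "u n / ereal (real n) \<le> ereal b"
        by (subst ereal_divide_le_pos) (auto simp: mult.commute)
      with b show ?case by auto
    qed
  qed
qed

text \<open>The hypotheses give one null set per threshold. Rational thresholds leave only countably
  many of them, and every real threshold is separated from \<open>g\<close> by a rational
  one.\<close>

lemma AE_tendsto_div_realI:
  fixes u :: "nat \<Rightarrow> 'a \<Rightarrow> ereal" and g :: ereal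
  assumes lo: "\<And>b. ereal b < g \<Longrightarrow> AE x in M. \<forall>\<^sub>F n in sequentially. ereal (b * real n) \<le> u n x"
    and up: "\<And>b. g < ereal b \<Longrightarrow> AE x in M. \<forall>\<^sub>F n in sequentially. u n x \<le> ereal (b * real n)"
  shows "AE x in M. (\<lambda>n. u n x / ereal (real n)) \<longlonglongrightarrow> g"
proof -
  have "AE x in M. \<forall>q\<in>\<rat>. ereal q < g \<longrightarrow> (\<forall>\<^sub>F n in sequentially. ereal (q * real n) \<le> u n x)"
    using lo by (intro AE_ball_countable[THEN iffD2] countable_rat) auto
  moreover have "AE x in M. \<forall>q\<in>\<rat>. g < ereal q \<longrightarrow> (\<forall>\<^sub>F n in sequentially. u n x \<le> ereal (q * real n))"
    using up by (intro AE_ball_countable[THEN iffD2] countable_rat) auto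
  ultimately show ?thesis
  proof eventually_elim
    case (elim x)
    show ?case unfolding tendsto_div_real_iff
    proof (intro conjI allI impI)
      fix b assume "ereal b < g"
      then obtain c where c: "ereal b < ereal c" "ereal c < g" using ereal_dense2 by blast
      then obtain q where q: "q \<in> \<rat>" "b < q" "q < c" using Rats_dense_in_real[of b c] by auto
      have "ereal q < g" using q c by (meson ereal_less_eq(3) less_eq_real_def order_le_less_trans)
      with elim(1) q have "\<forall>\<^sub>F n in sequentially. ereal (q * real n) \<le> u n x" by blast
      then show "\<forall>\<^sub>F n in sequentially. ereal (b * real n) \<le> u n x"
      proof eventually_elim
        case (elim n)
        have "ereal (b * real n) \<le> ereal (q * real n)" using q by (simp add: mult_right_mono)
        with elim show ?case by (rule order_trans[rotated])
      qed
    next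
      fix b assume "g < ereal b"
      then obtain c where c: "ereal c < ereal b" "g < ereal c" using ereal_dense2 by blast
      then obtain q where q: "q \<in> \<rat>" "c < q" "q < b" using Rats_dense_in_real[of c b] by auto
      have "g < ereal q" using q c by (meson ereal_less_eq(3) less_eq_real_def order_less_le_trans)
      with elim(2) q have "\<forall>\<^sub>F n in sequentially. u n x \<le> ereal (q * real n)" by blast
      then show "\<forall>\<^sub>F n in sequentially. u n x \<le> ereal (b * real n)"
      proof eventually_elim
        case (elim n)
        have "ereal (q * real n) \<le> ereal (b * real n)" using q by (simp add: mult_right_mono)
        with elim show ?case by (rule order_trans)
      qed
    qed
  qed
qed

lemma eventually_affine_le:
  fixes b c C :: real assumes "b < c"
  shows "\<forall>\<^sub>F n in sequentially. b * real n + C \<le> c * real n"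
proof -
  have "\<forall>\<^sub>F n in sequentially. real n \<ge> C / (c - b)"
    by (rule eventually_ge_at_top[THEN eventually_compose_filterlim[OF _ filterlim_real_sequentially]])
  then show ?thesis
  proof eventually_elim
    case (elim n)
    then show ?case using assms by (simp add: field_simps)
  qed
qed

text \<open>Since both limits exist, a comparison at infinitely many n is enough. This weak form is
  what the recurrence of a finite entry yields for forward products; the index shift and the
  constant \<open>r\<close> disappear in the rate.\<close>

lemma limit_le_of_frequently:
  fixes u v :: "nat \<Rightarrow> ereal"
  assumes u: "(\<lambda>n. u n / ereal (real n)) \<longlonglongrightarrow> a" and v: "(\<lambda>n. v n / ereal (real n)) \<longlonglongrightarrow> b"
    and le: "\<exists>\<^sub>F n in sequentially. ereal r + v n \<le> u (Suc n)"
  shows "b \<le> a"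
proof (rule ccontr)
  assume "\<not> b \<le> a"
  then have "a < b" by simp
  then obtain c where c: "a < ereal c" "ereal c < b" by (rule ereal_dense2[THEN exE]) blast
  from c(2) obtain d where d: "ereal c < ereal d" "ereal d < b" by (rule ereal_dense2[THEN exE]) blast
  have "\<forall>\<^sub>F n in sequentially. u n \<le> ereal (c * real n)"
    using u c(1) unfolding tendsto_div_real_iff by blast
  then have 1: "\<forall>\<^sub>F n in sequentially. u (Suc n) \<le> ereal (c * real (Suc n))"
    by (rule eventually_compose_filterlim[OF _ filterlim_Suc])
  have 2: "\<forall>\<^sub>F n in sequentially. ereal (d * real n) \<le> v n"
    using v d(2) unfolding tendsto_div_real_iff by blast
  \<comment> \<open>The constant collects \<open>c\<close> from the shifted index and
    \<open>- r\<close> from the additive term; the extra 1 makes the contradiction strict.\<close>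
  have 3: "\<forall>\<^sub>F n in sequentially. c * real n + (c - r + 1) \<le> d * real n"
    using d(1) by (intro eventually_affine_le) simp
  from 1 2 3 have "\<forall>\<^sub>F n in sequentially. \<not> ereal r + v n \<le> u (Suc n)"
  proof eventually_elim
    case (elim n)
    show ?case
    proof
      assume "ereal r + v n \<le> u (Suc n)"
      then have "ereal r + ereal (d * real n) \<le> ereal (c * real (Suc n))"
        using elim(1,2) add_left_mono order_trans by meson
      then show False using elim(3) by (simp add: algebra_simps)
    qed
  qed
  with le show False by (simp add: frequently_def)
qed

text \<open>The maximizing index may change with \<open>n\<close>, but finiteness of
  \<open>J\<close> would leave a single threshold strictly between all \<open>L i\<close> and
  \<open>g\<close>.\<close>

lemma limit_le_of_finite_max:
  fixes w :: "nat \<Rightarrow> ereal" and u :: "'i \<Rightarrow> nat \<Rightarrow> ereal"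
  assumes J: "finite J" "J \<noteq> {}"
    and w: "(\<lambda>n. w n / ereal (real n)) \<longlonglongrightarrow> g"
    and u: "\<And>i. i \<in> J \<Longrightarrow> (\<lambda>n. u i n / ereal (real n)) \<longlonglongrightarrow> L i"
    and le: "\<And>n. \<exists>i\<in>J. w (n + k) \<le> ereal r + u i n"
  shows "\<exists>i\<in>J. g \<le> L i"
proof (rule ccontr)
  assume "\<not> ?thesis"
  then have "Max (L ` J) < g" using J by (auto simp: not_le)
  then obtain b where b: "Max (L ` J) < ereal b" "ereal b < g" by (rule ereal_dense2[THEN exE]) blast
  from b(2) obtain c where c: "ereal b < ereal c" "ereal c < g" by (rule ereal_dense2[THEN exE]) blast
  have "\<forall>\<^sub>F n in sequentially. ereal (c * real n) \<le> w n"
    using w c(2) unfolding tendsto_div_real_iff by blast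
  then have 1: "\<forall>\<^sub>F n in sequentially. ereal (c * real (n + k)) \<le> w (n + k)"
    by (rule eventually_compose_filterlim[OF _ filterlim_add_const_nat_at_top])
  have "\<forall>i\<in>J. \<forall>\<^sub>F n in sequentially. u i n \<le> ereal (b * real n)"
  proof
    fix i assume i: "i \<in> J"
    then have "L i < ereal b" using b(1) J by simp
    then show "\<forall>\<^sub>F n in sequentially. u i n \<le> ereal (b * real n)"
      using u[OF i] unfolding tendsto_div_real_iff by blast
  qed
  then have 2: "\<forall>\<^sub>F n in sequentially. \<forall>i\<in>J. u i n \<le> ereal (b * real n)"
    by (intro eventually_ball_finite J)
  have 3: "\<forall>\<^sub>F n in sequentially. b * real n + (r - c * real k + 1) \<le> c * real n"
    using c(1) by (intro eventually_affine_le) simp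
  from 1 2 3 have "\<forall>\<^sub>F n in sequentially. False"
  proof eventually_elim
    case (elim n)
    obtain i where i: "i \<in> J" "w (n + k) \<le> ereal r + u i n" using le by blast
    have "ereal (c * real (n + k)) \<le> ereal r + ereal (b * real n)"
      using elim(1) i(2) add_left_mono[OF elim(2)[rule_format, OF i(1)], of "ereal r"]
      by (meson order_trans)
    then show ?case using elim(3) by (simp add: algebra_simps)
  qed
  then show False by simp
qed

section \<open>The subadditive ergodic theorem\<close>

text \<open>Walking along the orbit, jump over a block with slope at most \<open>b\<close> when the current time is
  good, and otherwise pay \<open>h\<close> for a single step; the last \<open>N\<close> steps absorb an incomplete block.\<close>

lemma greedy_bound:
  fixes F :: "nat \<Rightarrow> nat \<Rightarrow> ereal" and b :: real and h :: "nat \<Rightarrow> real"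
  assumes zero: "\<And>s. F s 0 \<le> 0"
    and sub: "\<And>s l m. F s (l + m) \<le> F s l + F (s + l) m"
    and one: "\<And>s. F s 1 \<le> ereal (b + h s)" and h0: "\<And>s. 0 \<le> h s"
    and good: "\<And>s. s \<notin> B \<Longrightarrow> \<exists>l\<in>{1..N}. F s l \<le> ereal (b * real l)"
  shows "F s l \<le> ereal (b * real l + (\<Sum>k\<in>{s..<s+l}. indicator B k * h k) + (\<Sum>k\<in>{s+l-N..<s+l}. h k))"
proof (induction l arbitrary: s rule: less_induct)
  case (less l)
  \<comment> \<open>Paying \<open>h\<close> at every step is the fallback for a block that would
    overshoot the end of the segment.\<close>
  have crude: "F s l \<le> ereal (b * real l + (\<Sum>k\<in>{s..<s+l}. h k))" for s l
  proof (induction l arbitrary: s)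
    case 0 show ?case using zero[of s] by (simp add: zero_ereal_def)
  next
    case (Suc l)
    have "F s (Suc l) \<le> F s 1 + F (s + 1) l" using sub[of s 1 l] by simp
    also have "\<dots> \<le> ereal (b + h s) + ereal (b * real l + (\<Sum>k\<in>{s+1..<s+1+l}. h k))"
      by (intro add_mono one Suc)
    finally show ?case by (simp add: sum.atLeast_Suc_lessThan algebra_simps del: sum.op_ivl_Suc)
  qed
  have ind0: "0 \<le> (\<Sum>k\<in>K. indicator B k * h k)" for K
    by (intro sum_nonneg mult_nonneg_nonneg h0) auto
  consider "l = 0" | "l > 0" "s \<in> B" | "l > 0" "s \<notin> B" by blast
  then show ?case
  proof cases
    case 1
    have "0 \<le> (\<Sum>k\<in>{s+l-N..<s+l}. h k)" by (intro sum_nonneg h0)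
    then show ?thesis using 1 zero[of s] by (auto intro: order_trans)
  next
    case 2
    then obtain m where m: "l = Suc m" using gr0_conv_Suc by auto
    have "F s l \<le> F s 1 + F (s + 1) m" using sub[of s 1 m] m by simp
    also have "\<dots> \<le> ereal (b + h s) + ereal (b * real m + (\<Sum>k\<in>{s+1..<s+1+m}. indicator B k * h k) + (\<Sum>k\<in>{s+1+m-N..<s+1+m}. h k))"
      using m by (intro add_mono one less) auto
    also have "\<dots> = ereal (b * real l + (h s + (\<Sum>k\<in>{s+1..<s+1+m}. indicator B k * h k)) + (\<Sum>k\<in>{s+1+m-N..<s+1+m}. h k))"
      using m by (simp add: algebra_simps)
    also have "h s + (\<Sum>k\<in>{s+1..<s+1+m}. indicator B k * h k) = (\<Sum>k\<in>{s..<s+l}. indicator B k * h k)"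
      using 2 m by (subst (2) sum.atLeast_Suc_lessThan) auto
    finally show ?thesis using m by simp
  next
    case 3
    then obtain k where k: "k \<in> {1..N}" "F s k \<le> ereal (b * real k)" using good by blast
    show ?thesis
    proof (cases "k \<le> l")
      case True
      then obtain m where m: "l = k + m" using le_Suc_ex by blast
      have "F s l \<le> F s k + F (s + k) m" using sub m by simp
      also have "\<dots> \<le> ereal (b * real k) + ereal (b * real m + (\<Sum>j\<in>{s+k..<s+k+m}. indicator B j * h j) + (\<Sum>j\<in>{s+k+m-N..<s+k+m}. h j))"
        using m k by (intro add_mono less) auto
      also have "\<dots> \<le> ereal (b * real l + (\<Sum>j\<in>{s..<s+l}. indicator B j * h j) + (\<Sum>j\<in>{s+l-N..<s+l}. h j))"
      proof -
        have "(\<Sum>j\<in>{s+k..<s+k+m}. indicator B j * h j) \<le> (\<Sum>j\<in>{s..<s+l}. indicator B j * h j)"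
          using m by (intro sum_mono2) (auto simp: h0)
        then show ?thesis using m by (simp add: algebra_simps)
      qed
      finally show ?thesis .
    next
      case False
      have "F s l \<le> ereal (b * real l + (\<Sum>j\<in>{s..<s+l}. h j))" by (rule crude)
      also have "\<dots> \<le> ereal (b * real l + (\<Sum>j\<in>{s..<s+l}. indicator B j * h j) + (\<Sum>j\<in>{s+l-N..<s+l}. h j))"
      proof -
        \<comment> \<open>Here \<open>l < k \<le> N\<close>, so the final window contains the whole
          segment, also when the subtraction is truncated at 0.\<close>
        have "(\<Sum>j\<in>{s..<s+l}. h j) \<le> (\<Sum>j\<in>{s+l-N..<s+l}. h j)"
          using False k by (intro sum_mono2) (auto simp: h0)
        then show ?thesis using ind0[of "{s..<s+l}"] unfolding ereal_less_eq by linarith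
      qed
      finally show ?thesis .
    qed
  qed
qed

section \<open>Ergodic maps, zero-one laws and the theorems of Birkhoff and Kingman\<close>

locale ergodic_map = prob_space M for M :: "'a measure" +
  fixes T :: "'a \<Rightarrow> 'a"
  assumes T_measurable [measurable]: "T \<in> measurable M M"
    and T_distr: "distr M M T = M"
    and T_ergodic: "\<And>B. B \<in> sets M \<Longrightarrow> T -` B \<inter> space M = B \<Longrightarrow> prob B \<in> {0, 1}"
begin

lemma iter_measurable [measurable]: "(T ^^ n) \<in> measurable M M"
  by (induction n) (auto intro: measurable_comp[OF _ T_measurable] simp: id_def)

lemma iter_distr: "distr M M (T ^^ n) = M"
proof (induction n)
  case 0 then show ?case by (simp add: id_def distr_id)
next
  case (Suc n)
  have "distr M M (T ^^ Suc n) = distr (distr M M (T ^^ n)) M T"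
    by (subst distr_distr) auto
  then show ?case by (simp only: Suc T_distr)
qed

lemma iter_space: "x \<in> space M \<Longrightarrow> (T ^^ n) x \<in> space M"
  using measurable_space[OF iter_measurable] .

lemma prob_iter_vimage:
  assumes "E \<in> sets M" shows "prob ((T ^^ n) -` E \<inter> space M) = prob E"
  using measure_distr[OF iter_measurable assms, of n] by (simp add: iter_distr)

lemma AE_iter: assumes "AE x in M. P x" shows "AE x in M. \<forall>n. P ((T ^^ n) x)"
proof (subst AE_all_countable, intro allI)
  fix n
  show "AE x in M. P ((T ^^ n) x)"
    using AE_distrD[OF iter_measurable, where P=P and n1=n] assms by (simp only: iter_distr)
qed

lemma integrable_iter:
  fixes g :: "'a \<Rightarrow> real" assumes "integrable M g" shows "integrable M (\<lambda>x. g ((T ^^ n) x))"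
  using integrable_distr[OF iter_measurable, where f=g and n1=n] assms by (simp add: iter_distr)

lemma integral_iter:
  fixes g :: "'a \<Rightarrow> real" assumes [measurable]: "g \<in> borel_measurable M"
  shows "(LINT x|M. g ((T ^^ n) x)) = (LINT x|M. g x)"
  using integral_distr[OF iter_measurable, where f=g and n1=n] assms by (simp add: iter_distr)

text \<open>The set \<open>B\<close> of points whose orbit stays in \<open>E\<close> from some time
  on is strictly invariant. It contains almost all of \<open>E\<close>, and it is no larger in
  measure: each \<open>C n\<close> lies in the preimage of \<open>E\<close> under
  \<open>T ^^ n\<close>, which has the measure of \<open>E\<close>.\<close>

lemma zero_one_subinvariant:
  assumes E [measurable]: "E \<in> sets M" and inv: "AE x in M. x \<in> E \<longrightarrow> T x \<in> E"
  shows "prob E \<in> {0, 1}"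
proof -
  define C where "C n = {x \<in> space M. \<forall>k\<ge>n. (T ^^ k) x \<in> E}" for n
  have [measurable]: "C n \<in> sets M" for n unfolding C_def by measurable
  define B where "B = (\<Union>n. C n)"
  have [measurable]: "B \<in> sets M" unfolding B_def by measurable
  have "T -` B \<inter> space M = B"
  proof (intro set_eqI iffI)
    fix x assume "x \<in> T -` B \<inter> space M"
    then obtain n where x: "x \<in> space M" "\<And>k. k \<ge> n \<Longrightarrow> (T ^^ k) (T x) \<in> E"
      unfolding B_def C_def by auto
    have "(T ^^ k) x \<in> E" if "k \<ge> Suc n" for k
      using that x(2)[of "k - 1"] by (cases k) (auto simp: funpow_swap1)
    with x show "x \<in> B" unfolding B_def C_def by blast
  next
    fix x assume "x \<in> B"
    then obtain n where x: "x \<in> space M" "\<And>k. k \<ge> n \<Longrightarrow> (T ^^ k) x \<in> E"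
      unfolding B_def C_def by auto
    have "(T ^^ k) (T x) \<in> E" if "k \<ge> n" for k
      using that x(2)[of "Suc k"] by (simp add: funpow_swap1)
    with x show "x \<in> T -` B \<inter> space M" unfolding B_def C_def
      using iter_space[of x 1] by auto
  qed
  then have B: "prob B \<in> {0, 1}" by (intro T_ergodic) auto
  have "AE x in M. x \<in> E \<longrightarrow> x \<in> B"
    using AE_iter[OF inv] AE_space
  proof eventually_elim
    case (elim x)
    show ?case
    proof
      assume "x \<in> E"
      then have "(T ^^ k) x \<in> E" for k
        using elim(1) by (induction k) auto
      with elim show "x \<in> B" unfolding B_def C_def by auto
    qed
  qed
  then have "prob E \<le> prob B" by (intro finite_measure_mono_AE) auto
  moreover have "prob B \<le> prob E"
  proof (rule LIMSEQ_le_const2)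
    have "incseq C" unfolding C_def incseq_def by fastforce
    then show "(\<lambda>n. prob (C n)) \<longlonglongrightarrow> prob B"
      unfolding B_def by (intro finite_Lim_measure_incseq) auto
    have "prob (C n) \<le> prob E" for n
    proof -
      have "prob (C n) \<le> prob ((T ^^ n) -` E \<inter> space M)"
        by (intro finite_measure_mono) (auto simp: C_def)
      then show ?thesis by (simp add: prob_iter_vimage)
    qed
    then show "\<exists>N. \<forall>n\<ge>N. prob (C n) \<le> prob E" by blast
  qed
  ultimately show ?thesis using B by simp
qed

text \<open>The slack above \<open>b\<close> makes the set invariant, although \<open>f (Suc n) x\<close> and \<open>f n (T x)\<close> differ
  by a summand.\<close>

definition drift_set :: "(nat \<Rightarrow> 'a \<Rightarrow> ereal) \<Rightarrow> real \<Rightarrow> 'a set" where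
  "drift_set f b = {x \<in> space M. \<exists>k. \<exists>N. \<forall>n\<ge>N. ereal ((b + 1 / real (Suc k)) * real n) \<le> f n x}"

text \<open>The countable slack \<open>1 / real (Suc k)\<close> in the definition serves
  measurability; proofs use an arbitrary slope \<open>c > b\<close>.\<close>

lemma drift_set_iff:
  "x \<in> drift_set f b \<longleftrightarrow> x \<in> space M \<and> (\<exists>c>b. \<forall>\<^sub>F n in sequentially. ereal (c * real n) \<le> f n x)"
proof
  assume "x \<in> drift_set f b"
  then obtain k where "x \<in> space M" "\<forall>\<^sub>F n in sequentially. ereal ((b + 1 / real (Suc k)) * real n) \<le> f n x"
    unfolding drift_set_def eventually_sequentially by blast
  then show "x \<in> space M \<and> (\<exists>c>b. \<forall>\<^sub>F n in sequentially. ereal (c * real n) \<le> f n x)"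
    by (intro conjI exI[of _ "b + 1 / real (Suc k)"]) auto
next
  assume "x \<in> space M \<and> (\<exists>c>b. \<forall>\<^sub>F n in sequentially. ereal (c * real n) \<le> f n x)"
  then obtain c where c: "x \<in> space M" "c > b" "\<forall>\<^sub>F n in sequentially. ereal (c * real n) \<le> f n x" by blast
  then obtain k where k: "1 / real (Suc k) < c - b"
    by (metis diff_gt_0_iff_gt reals_Archimedean inverse_eq_divide)
  have "\<forall>\<^sub>F n in sequentially. ereal ((b + 1 / real (Suc k)) * real n) \<le> f n x"
    using c(3)
  proof eventually_elim
    case (elim n)
    have "ereal ((b + 1 / real (Suc k)) * real n) \<le> ereal (c * real n)"
      using k by (auto intro!: mult_right_mono)
    with elim show ?case by (rule order_trans[rotated])
  qed
  with c show "x \<in> drift_set f b" unfolding drift_set_def eventually_sequentially by blast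
qed

lemma drift_set_measurable [measurable]:
  assumes [measurable]: "\<And>n. f n \<in> borel_measurable M"
  shows "drift_set f b \<in> sets M"
  unfolding drift_set_def by measurable

text \<open>The hypothesis bounds one step from above only, so a lower slope passes from
  \<open>x\<close> to \<open>T x\<close> but not back; this is why invariance is replaced by
  subinvariance. Any slope strictly between \<open>b\<close> and \<open>c\<close> absorbs the
  constant \<open>a x\<close>.\<close>

lemma drift_set_zero_one:
  assumes [measurable]: "\<And>n. f n \<in> borel_measurable M"
    and sub: "AE x in M. \<forall>n. f (Suc n) x \<le> ereal (a x) + f n (T x)"
  shows "prob (drift_set f b) \<in> {0, 1}"
proof (rule zero_one_subinvariant)
  show "AE x in M. x \<in> drift_set f b \<longrightarrow> T x \<in> drift_set f b"
    using sub AE_space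
  proof eventually_elim
    case (elim x)
    show ?case
    proof
      assume "x \<in> drift_set f b"
      then obtain c where c: "c > b" "\<forall>\<^sub>F n in sequentially. ereal (c * real n) \<le> f n x"
        unfolding drift_set_iff by blast
      obtain d where d: "b < d" "d < c" using dense c(1) by blast
      have "\<forall>\<^sub>F n in sequentially. ereal (c * real (Suc n)) \<le> f (Suc n) x"
        using c(2) by (rule eventually_compose_filterlim[OF _ filterlim_Suc])
      moreover have "\<forall>\<^sub>F n in sequentially. real n \<ge> (a x - c) / (c - d)"
        by (rule eventually_ge_at_top[THEN eventually_compose_filterlim[OF _ filterlim_real_sequentially]])
      ultimately have "\<forall>\<^sub>F n in sequentially. ereal (d * real n) \<le> f n (T x)"
      proof eventually_elim
        case (elim n)
        have "ereal (c * real (Suc n)) \<le> ereal (a x) + f n (T x)"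
          using elim(1) \<open>\<forall>n. f (Suc n) x \<le> ereal (a x) + f n (T x)\<close> by (blast intro: order_trans)
        then have "ereal (c * real (Suc n) - a x) \<le> f n (T x)"
          by (cases "f n (T x)") auto
        moreover have "d * real n \<le> c * real (Suc n) - a x"
          using elim(2) d by (simp add: field_simps)
        ultimately show ?case by (meson ereal_less_eq(3) order_trans)
      qed
      then show "T x \<in> drift_set f b" using d elim iter_space[of x 1] by (auto simp: drift_set_iff)
    qed
  qed
qed measurable

text \<open>When the zero-one law applies, this is the almost sure value of liminf
  \<open>f n x / n\<close>. The supremum of the empty set yields -\<infinity>, as happens for a
  trivial component.\<close>

definition drift :: "(nat \<Rightarrow> 'a \<Rightarrow> ereal) \<Rightarrow> ereal" where
  "drift f = Sup (ereal ` {b. prob (drift_set f b) = 1})"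

lemma AE_ge_below_drift:
  assumes [measurable]: "\<And>n. f n \<in> borel_measurable M"
  assumes "ereal b < drift f"
  shows "AE x in M. \<forall>\<^sub>F n in sequentially. ereal (b * real n) \<le> f n x"
proof -
  obtain c where c: "prob (drift_set f c) = 1" "b < c"
    using assms(2) unfolding drift_def less_Sup_iff by auto
  have "AE x in M. x \<in> drift_set f c" using c(1) by (simp add: AE_in_set_eq_1)
  then show ?thesis
  proof eventually_elim
    case (elim x)
    then obtain d where d: "d > c" "\<forall>\<^sub>F n in sequentially. ereal (d * real n) \<le> f n x"
      unfolding drift_set_iff by blast
    from d(2) show ?case
    proof eventually_elim
      case (elim n)
      have "ereal (b * real n) \<le> ereal (d * real n)" using d c by (auto intro!: mult_right_mono)
      with elim show ?case by (rule order_trans[rotated])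
    qed
  qed
qed

lemma drift_set_null_above_drift:
  assumes [measurable]: "\<And>n. f n \<in> borel_measurable M"
    and sub: "AE x in M. \<forall>n. f (Suc n) x \<le> ereal (a x) + f n (T x)"
    and "drift f < ereal b"
  shows "AE x in M. x \<notin> drift_set f b"
proof -
  have "prob (drift_set f b) \<noteq> 1"
  proof
    assume "prob (drift_set f b) = 1"
    then have "ereal b \<le> drift f" unfolding drift_def by (intro Sup_upper) auto
    with assms(3) show False by simp
  qed
  then have "prob (drift_set f b) = 0" using drift_set_zero_one[OF assms(1,2)] by auto
  then show ?thesis by (auto simp: AE_iff_measurable measure_eq_0_null_sets intro!: AE_not_in)
    (simp add: emeasure_eq_measure null_setsI)
qed

text \<open>A point is bad if no block of length at most \<open>N\<close> starting there has slope
  at most \<open>c\<close>. Outside the drift set some block always works, so the bad sets shrink to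
  a null set as \<open>N\<close> grows, and dominated convergence makes the integral of the penalty
  over them small.\<close>

lemma subadditive_greedy:
  fixes f :: "nat \<Rightarrow> 'a \<Rightarrow> ereal" and a :: "'a \<Rightarrow> real"
  assumes [measurable]: "\<And>n. f n \<in> borel_measurable M" and a: "integrable M a"
    and sub: "AE x in M. \<forall>n m. f (n + m) x \<le> f n x + f m ((T ^^ n) x)"
    and zero: "AE x in M. f 0 x \<le> 0" and one: "AE x in M. f 1 x \<le> ereal (a x)"
    and null: "AE x in M. x \<notin> drift_set f b" and "b < c" "0 < e"
  obtains B N where "B \<in> sets M" "(LINT x|M. indicator B x * max 0 (a x - c)) < e"
    "AE x in M. \<forall>s l. f l ((T ^^ s) x) \<le> ereal (c * real l
       + (\<Sum>k\<in>{s..<s+l}. indicator B ((T ^^ k) x) * max 0 (a ((T ^^ k) x) - c))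
       + (\<Sum>k\<in>{s+l-N..<s+l}. max 0 (a ((T ^^ k) x) - c)))"
proof -
  have [measurable]: "a \<in> borel_measurable M" using a by auto
  define h where "h x = max 0 (a x - c)" for x
  have h: "integrable M h" unfolding h_def using a by auto
  have [measurable]: "h \<in> borel_measurable M" using h by auto
  define B where "B n = {x \<in> space M. \<forall>l\<in>{1..n}. ereal (c * real l) < f l x}" for n
  have [measurable]: "B n \<in> sets M" for n unfolding B_def by measurable
  have "(\<lambda>n. LINT x|M. indicator (B n) x * h x) \<longlonglongrightarrow> (LINT x|M. 0)"
  proof (rule integral_dominated_convergence[where w=h])
    show "AE x in M. (\<lambda>n. indicator (B n) x * h x) \<longlonglongrightarrow> 0"
      using null AE_space
    proof eventually_elim
      case (elim x)
      \<comment> \<open>The strict inequality \<open>b < c\<close> matters: being outside the drift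
        set excludes only slopes above \<open>b\<close>.\<close>
      then have "\<not> (\<forall>\<^sub>F n in sequentially. ereal (c * real n) \<le> f n x)"
        using \<open>b < c\<close> unfolding drift_set_iff by blast
      then obtain l where l: "l \<ge> 1" "f l x < ereal (c * real l)"
        unfolding eventually_sequentially by (meson not_le)
      have "\<forall>\<^sub>F n in sequentially. indicator (B n) x * h x = 0"
        using eventually_ge_at_top[of l]
      proof eventually_elim
        case (elim n)
        then have "x \<notin> B n" using l unfolding B_def by (auto intro!: bexI[of _ l] simp: not_less)
        then show ?case by simp
      qed
      then show ?case by (rule tendsto_eventually)
    qed
    show "AE x in M. norm (indicator (B i) x * h x) \<le> h x" for i
      by (auto simp: h_def indicator_def)
  qed (use h in auto)
  then have "\<forall>\<^sub>F n in sequentially. (LINT x|M. indicator (B n) x * h x) < e"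
    using \<open>0 < e\<close> by (intro order_tendstoD(2)) auto
  then obtain N where N: "(LINT x|M. indicator (B N) x * h x) < e"
    unfolding eventually_sequentially by blast
  have "AE x in M. \<forall>s l. f l ((T ^^ s) x) \<le> ereal (c * real l
       + (\<Sum>k\<in>{s..<s+l}. indicator (B N) ((T ^^ k) x) * h ((T ^^ k) x))
       + (\<Sum>k\<in>{s+l-N..<s+l}. h ((T ^^ k) x)))"
    using AE_iter[OF sub] AE_iter[OF zero] AE_iter[OF one] AE_space
  proof eventually_elim
    case (elim x)
    show ?case
    proof (intro allI)
      fix s l
      let ?Bx = "{k. (T ^^ k) x \<in> B N}"
      have "f l ((T ^^ s) x) \<le> ereal (c * real l
         + (\<Sum>k\<in>{s..<s+l}. indicator ?Bx k * h ((T ^^ k) x))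
         + (\<Sum>k\<in>{s+l-N..<s+l}. h ((T ^^ k) x)))"
      proof (rule greedy_bound)
        show "f 0 ((T ^^ s) x) \<le> 0" for s using elim by blast
        show "f (l + m) ((T ^^ s) x) \<le> f l ((T ^^ s) x) + f m ((T ^^ (s + l)) x)" for s l m
        proof -
          have "(T ^^ l) ((T ^^ s) x) = (T ^^ (s + l)) x"
            by (simp add: funpow_add add.commute)
          then show ?thesis using elim(1)[rule_format, of l m s] by simp
        qed
        show "f 1 ((T ^^ s) x) \<le> ereal (c + h ((T ^^ s) x))" for s
        proof -
          have "ereal (a ((T ^^ s) x)) \<le> ereal (c + h ((T ^^ s) x))" by (simp add: h_def)
          with elim(3) show ?thesis by (blast intro: order_trans)
        qed
        show "0 \<le> h ((T ^^ s) x)" for s by (simp add: h_def)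
        show "\<exists>l\<in>{1..N}. f l ((T ^^ s) x) \<le> ereal (c * real l)" if "s \<notin> ?Bx" for s
          using that iter_space[OF elim(4), of s] unfolding B_def by (auto simp: not_less)
      qed
      then show "f l ((T ^^ s) x) \<le> ereal (c * real l
         + (\<Sum>k\<in>{s..<s+l}. indicator (B N) ((T ^^ k) x) * h ((T ^^ k) x))
         + (\<Sum>k\<in>{s+l-N..<s+l}. h ((T ^^ k) x)))"
        by (simp add: indicator_def)
    qed
  qed
  with N show thesis unfolding h_def by (intro that[of "B N" N]) auto
qed

text \<open>If slopes above \<open>b\<close> failed with probability 1, the greedy decomposition
  would bound orbit sums by a slope below the mean of \<open>g\<close>, up to a small penalty and a
  window of bounded mean. Integrating over \<open>m\<close> steps contradicts stationarity for large
  \<open>m\<close>.\<close>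

lemma birkhoff_lower:
  fixes g :: "'a \<Rightarrow> real"
  assumes g: "integrable M g" and b: "b < (LINT x|M. g x)"
  shows "AE x in M. \<forall>\<^sub>F n in sequentially. b * real n \<le> (\<Sum>k<n. g ((T ^^ k) x))"
proof -
  have [measurable]: "g \<in> borel_measurable M" using g by auto
  define f where "f n x = ereal (\<Sum>k<n. g ((T ^^ k) x))" for n x
  have [measurable]: "f n \<in> borel_measurable M" for n unfolding f_def by measurable
  have split: "f (n + m) x = f n x + f m ((T ^^ n) x)" for n m x
  proof -
    have "(\<Sum>k<n+m. g ((T ^^ k) x)) = (\<Sum>k<n. g ((T ^^ k) x)) + (\<Sum>k<m. g ((T ^^ (n + k)) x))"
      by (induction m) auto
    then show ?thesis by (simp add: f_def funpow_add add.commute[of n])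
  qed
  have zo: "prob (drift_set f b) \<in> {0, 1}"
  proof (rule drift_set_zero_one[where a=g])
    show "AE x in M. \<forall>n. f (Suc n) x \<le> ereal (g x) + f n (T x)"
      using split[of 1] by (simp add: f_def)
  qed measurable
  have "prob (drift_set f b) \<noteq> 0"
  proof
    assume "prob (drift_set f b) = 0"
    then have null: "AE x in M. x \<notin> drift_set f b"
      by (intro AE_not_in null_setsI) (auto simp: emeasure_eq_measure)
    \<comment> \<open>One third of the gap raises the slope above \<open>b\<close>, one third bounds
      the penalty on the bad set, and the last remains as margin for the contradiction.\<close>
    define e where "e = ((LINT x|M. g x) - b) / 3"
    have e: "e > 0" "b + e < (LINT x|M. g x) - e" using b by (auto simp: e_def field_simps)
    obtain B N where B [measurable]: "B \<in> sets M"
      and Be: "(LINT x|M. indicator B x * max 0 (g x - (b + e))) < e"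
      and bound: "AE x in M. \<forall>s l. f l ((T ^^ s) x) \<le> ereal ((b + e) * real l
       + (\<Sum>k\<in>{s..<s+l}. indicator B ((T ^^ k) x) * max 0 (g ((T ^^ k) x) - (b + e)))
       + (\<Sum>k\<in>{s+l-N..<s+l}. max 0 (g ((T ^^ k) x) - (b + e))))"
    proof (rule subadditive_greedy[of f g b "b + e" e])
      show "AE x in M. f 1 x \<le> ereal (g x)" by (simp add: f_def)
    qed (use split null e g in \<open>auto simp: f_def\<close>)
    define h where "h x = max 0 (g x - (b + e))" for x
    have h: "integrable M h" unfolding h_def using g by auto
    have [measurable]: "h \<in> borel_measurable M" using h by auto
    have h0: "h x \<ge> 0" for x by (simp add: h_def)
    define I where "I = (LINT x|M. indicator B x * h x)"
    define H where "H = (LINT x|M. h x)"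
    have H0: "H \<ge> 0" unfolding H_def by (simp add: h0)
    have hB: "integrable M (\<lambda>x. indicator B x * h x)"
      using integrable_real_mult_indicator[OF B h] by (simp add: mult.commute)
    have Ie: "I < e" using Be by (simp add: I_def h_def)
    have int: "integrable M (\<lambda>x. \<Sum>k<m. g ((T ^^ k) x))"
      "integrable M (\<lambda>x. \<Sum>k<m. indicator B ((T ^^ k) x) * h ((T ^^ k) x))"
      "integrable M (\<lambda>x. \<Sum>k\<in>{m-N..<m}. h ((T ^^ k) x))" for m
      using integrable_iter[OF g] integrable_iter[OF h] integrable_iter[OF hB]
      by (intro Bochner_Integration.integrable_sum; simp)+
    \<comment> \<open>By stationarity every summand integrates to the same value; the window has at
      most \<open>N\<close> terms, so its contribution does not grow with \<open>m\<close>.\<close>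
    have mean: "real m * (LINT x|M. g x) \<le> (b + e) * real m + real m * I + real N * H" for m
    proof -
      have "(LINT x|M. (\<Sum>k<m. g ((T ^^ k) x))) \<le> (LINT x|M. (b + e) * real m
         + (\<Sum>k<m. indicator B ((T ^^ k) x) * h ((T ^^ k) x)) + (\<Sum>k\<in>{m-N..<m}. h ((T ^^ k) x)))"
      proof (rule integral_mono_AE)
        show "AE x in M. (\<Sum>k<m. g ((T ^^ k) x)) \<le> (b + e) * real m
         + (\<Sum>k<m. indicator B ((T ^^ k) x) * h ((T ^^ k) x)) + (\<Sum>k\<in>{m-N..<m}. h ((T ^^ k) x))"
          using bound
        proof eventually_elim
          case (elim x)
          from elim[rule_format, of m 0] show ?case
            by (simp add: f_def h_def atLeast0LessThan del: sum_mult_indicator)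
        qed
      qed (intro Bochner_Integration.integrable_add int integrable_const)+
      also have "(LINT x|M. (\<Sum>k<m. g ((T ^^ k) x))) = real m * (LINT x|M. g x)"
        by (subst Bochner_Integration.integral_sum) (auto simp: integral_iter intro: integrable_iter g)
      also have "(LINT x|M. (b + e) * real m
         + (\<Sum>k<m. indicator B ((T ^^ k) x) * h ((T ^^ k) x)) + (\<Sum>k\<in>{m-N..<m}. h ((T ^^ k) x)))
         = (b + e) * real m + real m * I + real (card {m-N..<m}) * H"
      proof -
        have "(LINT x|M. (\<Sum>k<m. indicator B ((T ^^ k) x) * h ((T ^^ k) x))) = real m * I"
          by (subst Bochner_Integration.integral_sum)
            (auto simp: I_def integral_iter[of "\<lambda>x. indicator B x * h x"] intro: integrable_iter[OF hB])
        moreover have "(LINT x|M. (\<Sum>k\<in>{m-N..<m}. h ((T ^^ k) x))) = real (card {m-N..<m}) * H"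
          by (subst Bochner_Integration.integral_sum)
            (auto simp: H_def integral_iter intro: integrable_iter[OF h])
        ultimately show ?thesis
          by (simp only: Bochner_Integration.integral_add Bochner_Integration.integrable_add int
              integrable_const) (simp add: prob_space)
      qed
      also have "real (card {m-N..<m}) * H \<le> real N * H"
        using H0 by (intro mult_right_mono) auto
      finally show ?thesis by simp
    qed
    have "(LINT x|M. g x) - (b + e) - I > 0" using e Ie by simp
    then obtain m :: nat where "real N * H < real m * ((LINT x|M. g x) - (b + e) - I)"
      using reals_Archimedean3 by blast
    with mean[of m] show False by (simp add: algebra_simps)
  qed
  with zo have "prob (drift_set f b) = 1" by auto
  then have "AE x in M. x \<in> drift_set f b" by (simp add: AE_in_set_eq_1)
  then show ?thesis
  proof eventually_elim
    case (elim x)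
    then obtain d where d: "d > b" "\<forall>\<^sub>F n in sequentially. ereal (d * real n) \<le> f n x"
      unfolding drift_set_iff by blast
    from d(2) show ?case
    proof eventually_elim
      case (elim n)
      have "b * real n \<le> d * real n" using d by (auto intro!: mult_right_mono)
      with elim show ?case by (simp add: f_def)
    qed
  qed
qed

text \<open>The lower bound is applied to \<open>g\<close> and to \<open>- g\<close>; finitely many
  early times go into \<open>C\<close>. A bound valid for every n is needed because differences of
  two orbit sums will be taken at arbitrary times.\<close>

lemma birkhoff_bounds:
  fixes g :: "'a \<Rightarrow> real"
  assumes g: "integrable M g" and e: "e > 0"
  shows "AE x in M. \<exists>C\<ge>0. \<forall>n. \<bar>(\<Sum>k<n. g ((T ^^ k) x)) - (LINT x|M. g x) * real n\<bar> \<le> e * real n + C"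
proof -
  let ?E = "LINT x|M. g x"
  have "AE x in M. \<forall>\<^sub>F n in sequentially. (?E - e) * real n \<le> (\<Sum>k<n. g ((T ^^ k) x))"
    using e by (intro birkhoff_lower g) auto
  moreover have "AE x in M. \<forall>\<^sub>F n in sequentially. (- ?E - e) * real n \<le> (\<Sum>k<n. - g ((T ^^ k) x))"
    using e g by (intro birkhoff_lower[of "\<lambda>x. - g x"]) auto
  ultimately show ?thesis
  proof eventually_elim
    case (elim x)
    let ?d = "\<lambda>n. \<bar>(\<Sum>k<n. g ((T ^^ k) x)) - ?E * real n\<bar>"
    have "\<forall>\<^sub>F n in sequentially. ?d n \<le> e * real n"
      using elim by eventually_elim (auto simp: algebra_simps sum_negf)
    then obtain N where N: "\<And>n. n \<ge> N \<Longrightarrow> ?d n \<le> e * real n"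
      unfolding eventually_sequentially by blast
    have "?d n \<le> e * real n + (\<Sum>i<N. ?d i)" for n
    proof (cases "n < N")
      case True
      then have "?d n \<le> (\<Sum>i<N. ?d i)" by (intro member_le_sum) auto
      then show ?thesis using e by (simp add: add_increasing)
    next
      case False
      then show ?thesis using N[of n] by (simp add: add_increasing2 sum_nonneg)
    qed
    then show ?case by (intro exI[of _ "\<Sum>i<N. ?d i"]) (auto simp: sum_nonneg)
  qed
qed

text \<open>The greedy estimate starts at any point of the orbit with the same bad set and the same
  \<open>N\<close>. Its penalties are sums over pieces of one orbit, known only up to Birkhoff
  errors at absolute time; this is the origin of the term \<open>e * real (s + l)\<close>.\<close>

lemma subadditive_uniform_upper:
  fixes f :: "nat \<Rightarrow> 'a \<Rightarrow> ereal" and a :: "'a \<Rightarrow> real"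
  assumes [measurable]: "\<And>n. f n \<in> borel_measurable M" and a: "integrable M a"
    and sub: "AE x in M. \<forall>n m. f (n + m) x \<le> f n x + f m ((T ^^ n) x)"
    and zero: "AE x in M. f 0 x \<le> 0" and one: "AE x in M. f 1 x \<le> ereal (a x)"
    and b: "drift f < ereal b" and e: "0 < e"
  shows "AE x in M. \<exists>C. \<forall>s l. f l ((T ^^ s) x) \<le> ereal (b * real l + e * real (s + l) + C)"
proof -
  obtain b0 where b0: "drift f < ereal b0" "b0 < b" using ereal_dense2[OF b] by auto
  have "AE x in M. \<forall>n. f (Suc n) x \<le> ereal (a x) + f n (T x)"
    using sub one
  proof eventually_elim
    case (elim x)
    show ?case
    proof
      fix n
      have "f (Suc n) x \<le> f 1 x + f n (T x)" using elim(1)[rule_format, of 1 n] by simp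
      also have "\<dots> \<le> ereal (a x) + f n (T x)" by (intro add_right_mono elim)
      finally show "f (Suc n) x \<le> ereal (a x) + f n (T x)" .
    qed
  qed
  from drift_set_null_above_drift[OF assms(1) this b0(1)]
  have null: "AE x in M. x \<notin> drift_set f b0" .
  define h where "h x = max 0 (a x - b)" for x
  \<comment> \<open>A quarter of \<open>e\<close> for the integral over the bad set and a quarter
    for its Birkhoff error make \<open>e / 2\<close>; the final window below uses the other
    half.\<close>
  obtain B N where B: "B \<in> sets M" and Be: "(LINT x|M. indicator B x * h x) < e / 4"
    and bound: "AE x in M. \<forall>s l. f l ((T ^^ s) x) \<le> ereal (b * real l
       + (\<Sum>k\<in>{s..<s+l}. indicator B ((T ^^ k) x) * h ((T ^^ k) x))
       + (\<Sum>k\<in>{s+l-N..<s+l}. h ((T ^^ k) x)))"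
    using subadditive_greedy[OF assms(1) a sub zero one null b0(2), of "e / 4"] e
    unfolding h_def by auto
  have h: "integrable M h" unfolding h_def using a by auto
  have h0: "h x \<ge> 0" for x by (simp add: h_def)
  have hB: "integrable M (\<lambda>x. indicator B x * h x)"
    using integrable_real_mult_indicator[OF B h] by (simp add: mult.commute)
  have e4: "0 < e / 4" using e by simp
  define H where "H = (LINT x|M. h x)"
  have H0: "H \<ge> 0" unfolding H_def by (simp add: h0)
  show ?thesis
    using bound birkhoff_bounds[OF hB e4] birkhoff_bounds[OF h e4]
  proof eventually_elim
    case (elim x)
    let ?h = "\<lambda>k. h ((T ^^ k) x)" and ?k = "\<lambda>k. indicator B ((T ^^ k) x) * h ((T ^^ k) x)"
    obtain C1 where C1: "\<And>n. \<bar>(\<Sum>k<n. ?k k) - (LINT x|M. indicator B x * h x) * real n\<bar> \<le> e / 4 * real n + C1"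
      using elim(2) by blast
    obtain C2 where C2: "C2 \<ge> 0" "\<And>n. \<bar>(\<Sum>k<n. ?h k) - H * real n\<bar> \<le> e / 4 * real n + C2"
      using elim(3) unfolding H_def by blast
    show ?case
    proof (intro exI[of _ "C1 + H * real N + 2 * C2"] allI)
      fix s l :: nat
      define t where "t = s + l"
      have "(\<Sum>k\<in>{s..<t}. ?k k) \<le> (\<Sum>k<t. ?k k)"
        by (intro sum_mono2) (auto simp: h0)
      also have "\<dots> \<le> (LINT x|M. indicator B x * h x) * real t + e / 4 * real t + C1"
        using C1[of t] by linarith
      also have "(LINT x|M. indicator B x * h x) * real t \<le> e / 4 * real t"
        using Be by (intro mult_right_mono) auto
      finally have 2: "(\<Sum>k\<in>{s..<t}. ?k k) \<le> e / 2 * real t + C1" by simp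
      \<comment> \<open>As a difference of two orbit sums the window carries two Birkhoff errors,
        besides its mean of at most \<open>H * real N\<close>.\<close>
      have "(\<Sum>k\<in>{t-N..<t}. ?h k) = (\<Sum>k<t. ?h k) - (\<Sum>k<t-N. ?h k)"
        using sum.atLeastLessThan_concat[of 0 "t - N" t ?h] by (simp add: atLeast0LessThan)
      also have "\<dots> \<le> H * (real t - real (t - N)) + e / 4 * (real t + real (t - N)) + 2 * C2"
        using C2(2)[of t] C2(2)[of "t - N"] by (simp add: algebra_simps)
      also have "\<dots> \<le> H * real N + e / 4 * (real t + real t) + 2 * C2"
        using H0 e by (intro add_mono mult_left_mono) auto
      finally have 3: "(\<Sum>k\<in>{t-N..<t}. ?h k) \<le> H * real N + e / 2 * real t + 2 * C2" by simp
      have "f l ((T ^^ s) x) \<le> ereal (b * real l + (\<Sum>k\<in>{s..<t}. ?k k) + (\<Sum>k\<in>{t-N..<t}. ?h k))"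
        using elim(1) unfolding t_def by blast
      also have "\<dots> \<le> ereal (b * real l + e * real t + (C1 + H * real N + 2 * C2))"
        using 2 3 unfolding ereal_less_eq by simp
      finally show "f l ((T ^^ s) x) \<le> ereal (b * real l + e * real (s + l) + (C1 + H * real N + 2 * C2))"
        unfolding t_def .
    qed
  qed
qed

text \<open>Kingman's theorem. The value \<open>-\<infinity>\<close> is harmless because only upper bounds on
  \<open>f\<close> enter the greedy decomposition.\<close>

lemma subadditive_ergodic:
  fixes f :: "nat \<Rightarrow> 'a \<Rightarrow> ereal" and a :: "'a \<Rightarrow> real"
  assumes [measurable]: "\<And>n. f n \<in> borel_measurable M" and a: "integrable M a"
    and sub: "AE x in M. \<forall>n m. f (n + m) x \<le> f n x + f m ((T ^^ n) x)"
    and zero: "AE x in M. f 0 x \<le> 0" and one: "AE x in M. f 1 x \<le> ereal (a x)"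
  shows "drift f \<noteq> \<infinity>" "AE x in M. (\<lambda>n. f n x / ereal (real n)) \<longlonglongrightarrow> drift f"
proof -
  show "AE x in M. (\<lambda>n. f n x / ereal (real n)) \<longlonglongrightarrow> drift f"
  proof (rule AE_tendsto_div_realI)
    fix b assume "ereal b < drift f"
    then show "AE x in M. \<forall>\<^sub>F n in sequentially. ereal (b * real n) \<le> f n x"
      by (intro AE_ge_below_drift) auto
  next
    fix b assume b: "drift f < ereal b"
    then obtain c where c: "drift f < ereal c" "c < b" using ereal_dense2 by fastforce
    define e where "e = (b - c) / 2"
    have e: "e > 0" "c + e < b" using c by (auto simp: e_def field_simps)
    show "AE x in M. \<forall>\<^sub>F n in sequentially. f n x \<le> ereal (b * real n)"
      using subadditive_uniform_upper[OF assms c(1) e(1)]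
    proof eventually_elim
      case (elim x)
      then obtain C where C: "\<And>s l. f l ((T ^^ s) x) \<le> ereal (c * real l + e * real (s + l) + C)" by blast
      show ?case
        using eventually_affine_le[OF e(2), of C]
      proof eventually_elim
        case (elim n)
        have "f n x \<le> ereal (c * real n + e * real n + C)" using C[of n 0] by simp
        also have "\<dots> \<le> ereal (b * real n)" using elim by (simp add: algebra_simps)
        finally show ?case .
      qed
    qed
  qed
  show "drift f \<noteq> \<infinity>"
  proof
    assume inf: "drift f = \<infinity>"
    let ?E = "LINT x|M. a x"
    \<comment> \<open>\<open>f n\<close> is dominated by the orbit sums of \<open>a\<close>, which
      grow by at most \<open>?E + 1\<close> per step up to a constant, so slope
      \<open>?E + 2\<close> is impossible.\<close>
    have "AE x in M. \<forall>\<^sub>F n in sequentially. ereal ((?E + 2) * real n) \<le> f n x"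
      by (intro AE_ge_below_drift) (auto simp: inf)
    moreover note birkhoff_bounds[OF a, of 1, OF zero_less_one]
    ultimately have "AE x in M. False"
      using AE_iter[OF sub] AE_iter[OF one] zero
    proof eventually_elim
      case (elim x)
      have S: "f n x \<le> ereal (\<Sum>k<n. a ((T ^^ k) x))" for n
      proof (induction n)
        case 0 then show ?case using elim(5) by (simp add: zero_ereal_def)
      next
        case (Suc n)
        have "f (Suc n) x \<le> f n x + f 1 ((T ^^ n) x)" using elim(3)[rule_format, of n 1 0] by simp
        also have "\<dots> \<le> ereal (\<Sum>k<n. a ((T ^^ k) x)) + ereal (a ((T ^^ n) x))"
          by (intro add_mono Suc elim(4)[rule_format])
        finally show ?case by simp
      qed
      obtain C where C: "\<And>n. \<bar>(\<Sum>k<n. a ((T ^^ k) x)) - ?E * real n\<bar> \<le> 1 * real n + C"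
        using elim(2) by blast
      have "\<forall>\<^sub>F n in sequentially. (?E + 1) * real n + (C + 1) \<le> (?E + 2) * real n"
        by (rule eventually_affine_le) simp
      with elim(1) have "\<forall>\<^sub>F n in sequentially. False"
      proof eventually_elim
        case (elim n)
        have "ereal ((?E + 2) * real n) \<le> ereal (\<Sum>k<n. a ((T ^^ k) x))"
          using elim(1) S by (rule order_trans)
        then show ?case using elim(2) C[of n] by (simp add: algebra_simps)
      qed
      then show False by simp
    qed
    then show False by (simp add: AE_False)
  qed
qed

text \<open>A lower bound that holds eventually along \<open>f n x\<close> holds with large density along the
  reversed sequence \<open>f n (T ^^ n x)\<close>; the increment bound on the latter fills the gaps.\<close>

lemma reversed_lower:
  fixes f g :: "nat \<Rightarrow> 'a \<Rightarrow> ereal" and a :: "'a \<Rightarrow> real"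
  assumes [measurable]: "\<And>n. f n \<in> borel_measurable M" and a: "integrable M a"
    and a0: "\<And>x. a x \<ge> 0"
    and low: "AE x in M. \<forall>\<^sub>F n in sequentially. ereal (b * real n) \<le> f n x"
    and rev: "AE x in M. \<forall>n. g n x = f n ((T ^^ n) x)"
    and incr: "AE x in M. \<forall>k l. g (k + l) x \<le> g k x + ereal (\<Sum>j\<in>{k..<k+l}. a ((T ^^ j) x))"
    and c: "c < b"
  shows "AE x in M. \<forall>\<^sub>F n in sequentially. ereal (c * real n) \<le> g n x"
proof -
  have [measurable]: "a \<in> borel_measurable M" using a by auto
  define E where "E = (LINT x|M. a x)"
  have E0: "E \<ge> 0" unfolding E_def by (simp add: a0)
  \<comment> \<open>\<open>K\<close> bounds \<open>E + d - b\<close>, the loss per unit of time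
    spent waiting for a good time.\<close>
  define K where "K = \<bar>b\<bar> + E + 2"
  have K: "K > 0" using E0 by (simp add: K_def)
  \<comment> \<open>\<open>d\<close> bounds both the probability of the bad set and the Birkhoff
    errors. The bound 1/4 lets the gap estimate absorb the length of the gap itself; the other bound
    keeps the total loss \<open>(4 * K + 2) * d\<close> within half of \<open>b - c\<close>.\<close>
  define d where "d = min (1 / 4) ((b - c) / (2 * (4 * K + 2)))"
  have d: "d > 0" "d \<le> 1 / 4" using c K unfolding d_def by (simp_all del: min_less_iff_conj add: min_def)
  have "d \<le> (b - c) / (2 * (4 * K + 2))" by (simp add: d_def)
  then have "d * (4 * K + 2) \<le> (b - c) / 2" using K by (simp add: field_simps)
  then have dK: "c < b - (4 * K + 2) * d" using c by (simp add: algebra_simps)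
  define G where "G N = {x \<in> space M. \<exists>n\<ge>N. f n x < ereal (b * real n)}" for N
  have [measurable]: "G N \<in> sets M" for N unfolding G_def by measurable
  have "(\<lambda>N. prob (G N)) \<longlonglongrightarrow> prob (\<Inter>N. G N)"
    by (intro finite_Lim_measure_decseq) (auto simp: G_def decseq_def intro: order_trans)
  also have "prob (\<Inter>N. G N) = 0"
  proof -
    have "AE x in M. x \<notin> (\<Inter>N. G N)"
      using low by eventually_elim (auto simp: G_def eventually_sequentially not_less[symmetric])
    then show ?thesis by (subst prob_eq_0) auto
  qed
  finally have "\<forall>\<^sub>F N in sequentially. prob (G N) < d"
    using d by (intro order_tendstoD(2)) auto
  then obtain N where N: "prob (G N) < d" unfolding eventually_sequentially by blast
  have "AE x in M. \<exists>C\<ge>0. \<forall>n. \<bar>(\<Sum>k<n. indicator (G N) ((T ^^ k) x)) - (LINT x|M. indicator (G N) x) * real n\<bar> \<le> d * real n + C"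
    by (rule birkhoff_bounds) (auto intro!: integrable_real_indicator simp: emeasure_eq_measure d)
  with birkhoff_bounds[OF a d(1)] show ?thesis
    using AE_iter[OF AE_space] rev incr
  proof eventually_elim
    case (elim x)
    obtain C1 where C1: "C1 \<ge> 0" "\<And>n. \<bar>(\<Sum>k<n. a ((T ^^ k) x)) - E * real n\<bar> \<le> d * real n + C1"
      using elim(1) unfolding E_def by blast
    obtain C2 where C2: "C2 \<ge> 0" "\<And>n. \<bar>(\<Sum>k<n. indicator (G N) ((T ^^ k) x)) - (LINT x|M. indicator (G N) x) * real n\<bar> \<le> d * real n + C2"
      using elim(2) by blast
    define C where "C = K * (2 * C2 + 1) + 2 * C1"
    have main: "ereal ((b - (4 * K + 2) * d) * real n - C) \<le> g n x" if n: "n \<ge> N" for n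
    proof -
      \<comment> \<open>At most \<open>2 * d * t + C2\<close> bad times precede \<open>t\<close>.
        With \<open>d \<le> 1 / 4\<close>, if all of \<open>n, ..., n + r\<close> were bad, then
        \<open>r + 1 \<le> 4 * d * n + 2 * C2\<close>, which this choice of \<open>r\<close>
        excludes.\<close>
      define r where "r = nat \<lceil>4 * d * real n + 2 * C2\<rceil>"
      have r: "4 * d * real n + 2 * C2 \<le> real r" "real r \<le> 4 * d * real n + 2 * C2 + 1"
        using d C2(1) by (auto simp: r_def)
      have "\<exists>m\<in>{n..n+r}. (T ^^ m) x \<notin> G N"
      proof (rule ccontr)
        assume "\<not> ?thesis"
        then have "real (card {n..n+r}) = (\<Sum>k\<in>{n..n+r}. indicator (G N) ((T ^^ k) x))"
          by simp
        also have "\<dots> \<le> (\<Sum>k<n+r+1. indicator (G N) ((T ^^ k) x))"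
          by (intro sum_mono2) auto
        also have "\<dots> \<le> (LINT x|M. indicator (G N) x) * real (n+r+1) + d * real (n+r+1) + C2"
          using C2(2)[of "n + r + 1"] by linarith
        also have "(LINT x|M. indicator (G N) x) * real (n+r+1) \<le> d * real (n+r+1)"
          using N by (intro mult_right_mono) auto
        finally have "real r + 1 \<le> 2 * d * real n + 2 * d * (real r + 1) + C2"
          by (simp add: algebra_simps)
        also have "2 * d * (real r + 1) \<le> 1 / 2 * (real r + 1)"
          using d by (intro mult_right_mono) auto
        finally show False using r(1) by (simp add: field_simps)
      qed
      then obtain l where l: "l \<le> r" "(T ^^ (n + l)) x \<notin> G N"
        by (metis atLeastAtMost_iff le_Suc_ex nat_add_left_cancel_le)
      \<comment> \<open>Avoiding \<open>G N\<close> at time \<open>n + l\<close> gives the lower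
        bound for every length at least \<open>N\<close>; the reversed sequence evaluates the length
        \<open>n + l\<close> itself.\<close>
      have "ereal (b * real (n + l)) \<le> g (n + l) x"
        using l(2) n elim(3,4) unfolding G_def by (auto simp: not_less simp del: of_nat_add)
      also have "\<dots> \<le> g n x + ereal (\<Sum>j\<in>{n..<n+l}. a ((T ^^ j) x))" using elim(5) by blast
      finally have *: "ereal (b * real (n + l) - (\<Sum>j\<in>{n..<n+l}. a ((T ^^ j) x))) \<le> g n x"
        by (cases "g n x") auto
      have "(\<Sum>j\<in>{n..<n+l}. a ((T ^^ j) x)) = (\<Sum>j<n+l. a ((T ^^ j) x)) - (\<Sum>j<n. a ((T ^^ j) x))"
        using sum.atLeastLessThan_concat[of 0 n "n + l" "\<lambda>j. a ((T ^^ j) x)"] by (simp add: atLeast0LessThan)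
      also have "\<dots> \<le> E * real l + d * (2 * real n + real l) + 2 * C1"
        using C1(2)[of "n + l"] C1(2)[of n] by (simp add: algebra_simps)
      finally have "b * real (n + l) - (\<Sum>j\<in>{n..<n+l}. a ((T ^^ j) x))
          \<ge> b * real n - 2 * d * real n - (E + d - b) * real l - 2 * C1"
        by (simp add: algebra_simps)
      moreover have "(E + d - b) * real l \<le> K * real r"
        using d l E0 by (intro mult_mono) (auto simp: K_def)
      moreover have "K * real r \<le> K * (4 * d * real n + 2 * C2 + 1)"
        using r K by (intro mult_left_mono) auto
      ultimately have "(b - (4 * K + 2) * d) * real n - C \<le> b * real (n + l) - (\<Sum>j\<in>{n..<n+l}. a ((T ^^ j) x))"
        by (simp add: C_def algebra_simps)
      with * show ?thesis by (meson ereal_less_eq(3) order_trans)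
    qed
    show ?case using eventually_affine_le[OF dK, of C] eventually_ge_at_top[of N]
    proof eventually_elim
      case (elim n)
      have "ereal (c * real n) \<le> ereal ((b - (4 * K + 2) * d) * real n - C)" using elim(1) by simp
      with main[OF elim(2)] show ?case by (rule order_trans[rotated])
    qed
  qed
qed

text \<open>Recurrence: by Birkhoff the number of visits grows linearly, while an orbit that leaves
  \<open>E\<close> for good makes boundedly many.\<close>

lemma AE_infinitely_often:
  assumes [measurable]: "E \<in> sets M" and pos: "prob E > 0"
  shows "AE x in M. \<exists>\<^sub>F n in sequentially. (T ^^ n) x \<in> E"
proof -
  have "AE x in M. \<forall>\<^sub>F n in sequentially. prob E / 2 * real n \<le> (\<Sum>k<n. indicator E ((T ^^ k) x))"
    by (rule birkhoff_lower) (auto intro!: integrable_real_indicator simp: emeasure_eq_measure pos)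
  then show ?thesis
  proof eventually_elim
    case (elim x)
    show ?case unfolding frequently_def
    proof
      assume "\<forall>\<^sub>F n in sequentially. \<not> (T ^^ n) x \<in> E"
      then obtain N where N: "\<And>n. n \<ge> N \<Longrightarrow> (T ^^ n) x \<notin> E"
        unfolding eventually_sequentially by blast
      have "\<forall>\<^sub>F n in sequentially. 0 * real n + (real N + 1) \<le> prob E / 2 * real n"
        using pos by (intro eventually_affine_le) auto
      with elim have "\<forall>\<^sub>F n in sequentially. False"
      proof eventually_elim
        case (elim n)
        have "(\<Sum>k<n. indicator E ((T ^^ k) x)) \<le> (\<Sum>k<n. indicator {..<N} k :: real)"
          using N by (intro sum_mono) (auto simp: indicator_def simp flip: not_le)
        also have "\<dots> = real (card ({..<n} \<inter> {..<N}))"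
          by (simp add: indicator_def[abs_def] sum.If_cases lessThan_def)
        also have "\<dots> \<le> real N"
          using card_mono[of "{..<N}" "{..<n} \<inter> {..<N}"] by simp
        finally show ?case using elim by simp
      qed
      then show False by simp
    qed
  qed
qed

end

section \<open>Products of max-plus matrices\<close>

lemma mp_mult_ge: "finite S \<Longrightarrow> k \<in> S \<Longrightarrow> X i k + Y k j \<le> mp_mult S X Y i j"
  unfolding mp_mult_def by (intro Max_ge) auto

lemma mp_mult_witness:
  assumes "finite S" "S \<noteq> {}"
  obtains k where "k \<in> S" "mp_mult S X Y i j = X i k + Y k j"
proof -
  have "mp_mult S X Y i j \<in> (\<lambda>k. X i k + Y k j) ` S"
    unfolding mp_mult_def using assms by (intro Max_in) auto
  then show thesis using that by blast
qed

lemma max_entry_ge: "finite S \<Longrightarrow> i \<in> S \<Longrightarrow> j \<in> S \<Longrightarrow> X i j \<le> max_entry S X"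
  unfolding max_entry_def by (intro Max_ge) auto

lemma max_entry_witness:
  assumes "finite S" "S \<noteq> {}"
  obtains i j where "i \<in> S" "j \<in> S" "max_entry S X = X i j"
proof -
  have "max_entry S X \<in> (\<lambda>(i, j). X i j) ` (S \<times> S)"
    unfolding max_entry_def using assms by (intro Max_in) auto
  then obtain p where "p \<in> S \<times> S" "max_entry S X = (\<lambda>(i, j). X i j) p" by (rule imageE)
  then show thesis using that[of "fst p" "snd p"] by (auto simp: case_prod_beta mem_Times_iff)
qed

section \<open>The two shifts and the cutting of products\<close>

definition advance :: "(int \<Rightarrow> 'e) \<Rightarrow> int \<Rightarrow> 'e" where "advance s = (\<lambda>k. s (k + 1))"
definition retreat :: "(int \<Rightarrow> 'e) \<Rightarrow> int \<Rightarrow> 'e" where "retreat s = (\<lambda>k. s (k - 1))"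

lemma advance_retreat [simp]: "advance (retreat s) = s" "retreat (advance s) = s"
  by (auto simp: advance_def retreat_def)

lemma advance_iter: "(advance ^^ n) s = (\<lambda>k. s (k + int n))"
  by (induction n) (auto simp: advance_def algebra_simps)

lemma retreat_iter: "(retreat ^^ n) s = (\<lambda>k. s (k - int n))"
  by (induction n) (auto simp: retreat_def algebra_simps)

text \<open>In \<open>ereal\<close> the sum of \<infinity> and -\<infinity> is \<infinity>, so an
  entry -\<infinity> annihilates a path only where \<infinity> is excluded.\<close>

definition no_top :: "(int \<Rightarrow> 'd mp_mat) \<Rightarrow> bool" where
  "no_top s \<longleftrightarrow> (\<forall>n i j. s n i j \<noteq> \<infinity>)"

lemma no_top_iter: "no_top s \<Longrightarrow> no_top ((advance ^^ n) s)" "no_top s \<Longrightarrow> no_top ((retreat ^^ n) s)"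
  by (auto simp: no_top_def advance_iter retreat_iter)

lemma no_top_step: "no_top s \<Longrightarrow> no_top (advance s)" "no_top s \<Longrightarrow> no_top (retreat s)"
  using no_top_iter[of s 1] by auto

lemma mp_one_mult:
  assumes "finite S" "i \<in> S" "\<And>k. X k j \<noteq> \<infinity>"
  shows "mp_mult S mp_one X i j = X i j"
proof (rule antisym)
  obtain k where "k \<in> S" "mp_mult S mp_one X i j = mp_one i k + X k j"
    using mp_mult_witness[of S] assms by blast
  then show "mp_mult S mp_one X i j \<le> X i j"
    using assms(3)[of k] by (cases "X k j") (auto simp: mp_one_def split: if_splits)
  show "X i j \<le> mp_mult S mp_one X i j"
    using mp_mult_ge[OF assms(1,2), of mp_one i X j] by (simp add: mp_one_def)
qed

lemma mp_mult_one:
  assumes "finite S" "j \<in> S" "\<And>k. X i k \<noteq> \<infinity>"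
  shows "mp_mult S X mp_one i j = X i j"
proof (rule antisym)
  obtain k where "k \<in> S" "mp_mult S X mp_one i j = X i k + mp_one k j"
    using mp_mult_witness[of S] assms by blast
  then show "mp_mult S X mp_one i j \<le> X i j"
    using assms(3)[of k] by (cases "X i k") (auto simp: mp_one_def split: if_splits)
  show "X i j \<le> mp_mult S X mp_one i j"
    using mp_mult_ge[OF assms(1,2), of X i mp_one j] by (simp add: mp_one_def)
qed

text \<open>Cut an optimal path after its first \<open>n\<close> arcs; \<open>k\<close> is the node
  reached there.\<close>

lemma backward_prod_split:
  assumes "finite S" "i \<in> S" "j \<in> S"
  shows "\<exists>k\<in>S. backward_prod S s (n + m) i j \<le> backward_prod S s n i k + backward_prod S ((retreat ^^ n) s) m k j"
  using assms(3)
proof (induction m arbitrary: j)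
  case 0
  then show ?case by (intro bexI[of _ j]) (auto simp: mp_one_def)
next
  case (Suc m)
  obtain l where l: "l \<in> S" "backward_prod S s (n + Suc m) i j
      = backward_prod S s (n + m) i l + s (- int (Suc (n + m))) l j"
    using mp_mult_witness[of S] assms by (metis add_Suc_right backward_prod.simps(2) empty_iff)
  obtain k where k: "k \<in> S" "backward_prod S s (n + m) i l \<le> backward_prod S s n i k + backward_prod S ((retreat ^^ n) s) m k l"
    using Suc.IH[OF l(1)] by blast
  have "backward_prod S s (n + Suc m) i j
      \<le> backward_prod S s n i k + backward_prod S ((retreat ^^ n) s) m k l + s (- int (Suc (n + m))) l j"
    unfolding l(2) by (intro add_right_mono k)
  also have "\<dots> = backward_prod S s n i k + (backward_prod S ((retreat ^^ n) s) m k l + (retreat ^^ n) s (- int (Suc m)) l j)"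
    by (simp add: retreat_iter algebra_simps)
  also have "\<dots> \<le> backward_prod S s n i k + backward_prod S ((retreat ^^ n) s) (Suc m) k j"
    unfolding backward_prod.simps by (intro add_left_mono mp_mult_ge assms l)
  finally show ?case using k by blast
qed

text \<open>The latest matrix stands on the left, so the matrices at times below \<open>n\<close>
  belong to the final arcs of the path and form the right factor.\<close>

lemma forward_prod_split:
  assumes "finite S" "i \<in> S" "j \<in> S"
  shows "\<exists>k\<in>S. forward_prod S s (n + m) i j \<le> forward_prod S ((advance ^^ n) s) m i k + forward_prod S s n k j"
  using assms(2)
proof (induction m arbitrary: i)
  case 0
  then show ?case by (intro bexI[of _ i]) (auto simp: mp_one_def)
next
  case (Suc m)
  obtain l where l: "l \<in> S" "forward_prod S s (n + Suc m) i j
      = s (int (n + m)) i l + forward_prod S s (n + m) l j"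
    using mp_mult_witness[of S] assms by (metis add_Suc_right forward_prod.simps(2) empty_iff)
  obtain k where k: "k \<in> S" "forward_prod S s (n + m) l j \<le> forward_prod S ((advance ^^ n) s) m l k + forward_prod S s n k j"
    using Suc.IH[OF l(1)] by blast
  have "forward_prod S s (n + Suc m) i j
      \<le> s (int (n + m)) i l + (forward_prod S ((advance ^^ n) s) m l k + forward_prod S s n k j)"
    unfolding l(2) by (intro add_left_mono k)
  also have "\<dots> = ((advance ^^ n) s (int m) i l + forward_prod S ((advance ^^ n) s) m l k) + forward_prod S s n k j"
    by (simp add: advance_iter algebra_simps)
  also have "\<dots> \<le> forward_prod S ((advance ^^ n) s) (Suc m) i k + forward_prod S s n k j"
    unfolding forward_prod.simps by (intro add_right_mono mp_mult_ge assms l)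
  finally show ?case using k by blast
qed

lemma backward_prod_1:
  "finite S \<Longrightarrow> i \<in> S \<Longrightarrow> no_top s \<Longrightarrow> backward_prod S s 1 i j = s (-1) i j"
  by (simp add: mp_one_mult no_top_def)

lemma forward_prod_1:
  "finite S \<Longrightarrow> j \<in> S \<Longrightarrow> no_top s \<Longrightarrow> forward_prod S s 1 i j = s 0 i j"
  by (simp add: mp_mult_one no_top_def)

text \<open>The recursion adds the oldest matrix on the right. Analysing a fixed row needs the first
  arc instead, which uses the matrix at time -1 and leaves a product over the retreated
  trajectory.\<close>

lemma backward_prod_Suc_left:
  assumes "finite S" "i \<in> S" "j \<in> S" "no_top s"
  shows "backward_prod S s (Suc n) i j = mp_mult S (s (-1)) (backward_prod S (retreat s) n) i j"
proof (rule antisym)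
  obtain k where k: "k \<in> S" "backward_prod S s (1 + n) i j \<le> backward_prod S s 1 i k + backward_prod S ((retreat ^^ 1) s) n k j"
    using backward_prod_split[OF assms(1-3)] by blast
  then have "backward_prod S s (Suc n) i j \<le> s (-1) i k + backward_prod S (retreat s) n k j"
    using backward_prod_1[OF assms(1,2,4)] by simp
  also have "\<dots> \<le> mp_mult S (s (-1)) (backward_prod S (retreat s) n) i j"
    by (rule mp_mult_ge[OF assms(1) k(1)])
  finally show "backward_prod S s (Suc n) i j \<le> mp_mult S (s (-1)) (backward_prod S (retreat s) n) i j" .
next
  have "s (-1) i k + backward_prod S (retreat s) n k j \<le> backward_prod S s (Suc n) i j" if "k \<in> S" for k
    using assms(3)
  proof (induction n arbitrary: j)
    case 0
    have "s (-1) i k + mp_one k j \<le> mp_mult S (s (-1)) mp_one i j"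
      by (rule mp_mult_ge[OF assms(1) that])
    also have "\<dots> = backward_prod S s 1 i j"
      using 0 assms by (simp add: mp_mult_one mp_one_mult no_top_def)
    finally show ?case by simp
  next
    case (Suc n)
    obtain l where l: "l \<in> S" "backward_prod S (retreat s) (Suc n) k j
        = backward_prod S (retreat s) n k l + retreat s (- int (Suc n)) l j"
      using mp_mult_witness[of S] assms by (metis backward_prod.simps(2) empty_iff)
    have "s (-1) i k + backward_prod S (retreat s) (Suc n) k j
        = (s (-1) i k + backward_prod S (retreat s) n k l) + s (- int (Suc (Suc n))) l j"
      unfolding l(2) by (simp add: retreat_def algebra_simps)
    also have "\<dots> \<le> backward_prod S s (Suc n) i l + s (- int (Suc (Suc n))) l j"
      by (intro add_right_mono Suc.IH l)
    also have "\<dots> \<le> backward_prod S s (Suc (Suc n)) i j"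
      unfolding backward_prod.simps(2)[of S s "Suc n"] by (rule mp_mult_ge[OF assms(1) l(1)])
    finally show ?case .
  qed
  then show "mp_mult S (s (-1)) (backward_prod S (retreat s) n) i j \<le> backward_prod S s (Suc n) i j"
    using mp_mult_witness[of S] assms by (metis empty_iff)
qed

text \<open>Both products multiply the same matrices in the same order, seen from time 0 and from
  time -n. The starting point moves with \<open>n\<close>, so pathwise limits are not carried
  over.\<close>

lemma backward_eq_forward:
  assumes "finite S" "no_top s" "i \<in> S" "j \<in> S"
  shows "backward_prod S s n i j = forward_prod S ((retreat ^^ n) s) n i j"
  using assms(2,3,4)
proof (induction n arbitrary: s i j)
  case 0 then show ?case by simp
next
  case (Suc n)
  have "backward_prod S s (Suc n) i j = mp_mult S (s (-1)) (backward_prod S (retreat s) n) i j"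
    using Suc.prems assms by (intro backward_prod_Suc_left) auto
  also have "\<dots> = mp_mult S (s (-1)) (forward_prod S ((retreat ^^ n) (retreat s)) n) i j"
    unfolding mp_mult_def using Suc.IH[OF no_top_step(2)[OF Suc.prems(1)] _ Suc.prems(3)]
    by (intro arg_cong[where f=Max] image_cong refl arg_cong2[where f="(+)"]) auto
  also have "\<dots> = forward_prod S ((retreat ^^ Suc n) s) (Suc n) i j"
    by (simp add: funpow_swap1) (simp add: retreat_iter retreat_def)
  finally show ?case .
qed

lemma forward_eq_backward:
  assumes "finite S" "no_top s" "i \<in> S" "j \<in> S"
  shows "forward_prod S s n i j = backward_prod S ((advance ^^ n) s) n i j"
proof -
  have "(retreat ^^ n) ((advance ^^ n) s) = s" by (simp add: advance_iter retreat_iter)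
  then show ?thesis using backward_eq_forward[OF assms(1) no_top_iter(1)[OF assms(2)] assms(3,4), of n n] by simp
qed

section \<open>Subadditivity of the largest entry\<close>

abbreviation max_backward :: "'d set \<Rightarrow> nat \<Rightarrow> (int \<Rightarrow> 'd mp_mat) \<Rightarrow> ereal" where
  "max_backward S n s \<equiv> max_entry S (backward_prod S s n)"

abbreviation max_forward :: "'d set \<Rightarrow> nat \<Rightarrow> (int \<Rightarrow> 'd mp_mat) \<Rightarrow> ereal" where
  "max_forward S n s \<equiv> max_entry S (forward_prod S s n)"

lemma max_entry_cong:
  "(\<And>i j. i \<in> S \<Longrightarrow> j \<in> S \<Longrightarrow> X i j = Y i j) \<Longrightarrow> max_entry S X = max_entry S Y"
  unfolding max_entry_def by (intro arg_cong[where f=Max] image_cong) auto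

lemma max_entry_mp_one: "finite S \<Longrightarrow> S \<noteq> {} \<Longrightarrow> max_entry S mp_one = 0"
proof (rule antisym)
  assume S: "finite S" "S \<noteq> {}"
  obtain i j :: 'a where "max_entry S mp_one = mp_one i j"
    using max_entry_witness[OF S] by metis
  then show "max_entry S mp_one \<le> 0" by (simp add: mp_one_def)
  obtain i where "i \<in> S" using S by blast
  then show "0 \<le> max_entry S mp_one" using max_entry_ge[OF S(1), of i i mp_one] by (simp add: mp_one_def)
qed

lemma max_backward_subadd:
  assumes "finite S" "S \<noteq> {}"
  shows "max_backward S (n + m) s \<le> max_backward S n s + max_backward S m ((retreat ^^ n) s)"
proof -
  obtain i j where ij: "i \<in> S" "j \<in> S" "max_backward S (n + m) s = backward_prod S s (n + m) i j"
    using max_entry_witness[OF assms] .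
  obtain k where "k \<in> S" "backward_prod S s (n + m) i j \<le> backward_prod S s n i k + backward_prod S ((retreat ^^ n) s) m k j"
    using backward_prod_split[OF assms(1) ij(1,2)] by blast
  then show ?thesis unfolding ij(3) using ij assms
    by (auto intro: order_trans add_mono max_entry_ge)
qed

lemma max_forward_subadd:
  assumes "finite S" "S \<noteq> {}"
  shows "max_forward S (n + m) s \<le> max_forward S n s + max_forward S m ((advance ^^ n) s)"
proof -
  obtain i j where ij: "i \<in> S" "j \<in> S" "max_forward S (n + m) s = forward_prod S s (n + m) i j"
    using max_entry_witness[OF assms] .
  obtain k where k: "k \<in> S" "forward_prod S s (n + m) i j \<le> forward_prod S ((advance ^^ n) s) m i k + forward_prod S s n k j"
    using forward_prod_split[OF assms(1) ij(1,2)] by blast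
  note k(2)
  also have "forward_prod S ((advance ^^ n) s) m i k + forward_prod S s n k j \<le> max_forward S m ((advance ^^ n) s) + max_forward S n s"
    using ij assms k by (intro add_mono max_entry_ge)
  finally show ?thesis unfolding ij(3) by (simp add: add.commute)
qed

lemma max_backward_eq_forward:
  assumes "finite S" "no_top s"
  shows "max_backward S n s = max_forward S n ((retreat ^^ n) s)"
    "max_forward S n s = max_backward S n ((advance ^^ n) s)"
  by (intro max_entry_cong backward_eq_forward forward_eq_backward assms; assumption)+

section \<open>Products restricted to subsets of the nodes\<close>

lemma backward_prod_mono:
  assumes "finite S'" "S \<subseteq> S'" "i \<in> S" "j \<in> S"
  shows "backward_prod S s n i j \<le> backward_prod S' s n i j"
  using assms(4)
proof (induction n arbitrary: j)
  case (Suc n)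
  have fS: "finite S" using assms(1,2) by (rule finite_subset[rotated])
  then obtain k where k: "k \<in> S" "backward_prod S s (Suc n) i j = backward_prod S s n i k + s (- int (Suc n)) k j"
    using mp_mult_witness[of S] assms by (metis backward_prod.simps(2) empty_iff)
  note k(2)
  also have "backward_prod S s n i k + s (- int (Suc n)) k j \<le> backward_prod S' s n i k + s (- int (Suc n)) k j"
    by (intro add_right_mono Suc k)
  also have "\<dots> \<le> backward_prod S' s (Suc n) i j"
    unfolding backward_prod.simps using assms k by (intro mp_mult_ge) auto
  finally show ?case .
qed simp

lemma forward_prod_mono:
  assumes "finite S'" "S \<subseteq> S'" "i \<in> S" "j \<in> S"
  shows "forward_prod S s n i j \<le> forward_prod S' s n i j"
  using assms(3)
proof (induction n arbitrary: i)
  case (Suc n)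
  have fS: "finite S" using assms(1,2) by (rule finite_subset[rotated])
  then obtain k where k: "k \<in> S" "forward_prod S s (Suc n) i j = s (int n) i k + forward_prod S s n k j"
    using mp_mult_witness[of S] assms by (metis forward_prod.simps(2) empty_iff)
  note k(2)
  also have "s (int n) i k + forward_prod S s n k j \<le> s (int n) i k + forward_prod S' s n k j"
    by (intro add_left_mono Suc k)
  also have "\<dots> \<le> forward_prod S' s (Suc n) i j"
    unfolding forward_prod.simps using assms k by (intro mp_mult_ge) auto
  finally show ?case .
qed simp

lemma backward_prod_no_top:
  assumes "finite S" "S \<noteq> {}" "no_top s"
  shows "backward_prod S s n i j \<noteq> \<infinity>"
proof (induction n arbitrary: j)
  case 0 then show ?case by (simp add: mp_one_def)
next
  case (Suc n)
  obtain k where "backward_prod S s (Suc n) i j = backward_prod S s n i k + s (- int (Suc n)) k j"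
    using mp_mult_witness[OF assms(1,2)] by (metis backward_prod.simps(2))
  moreover have "s (- int (Suc n)) k j \<noteq> \<infinity>" using assms(3) unfolding no_top_def by blast
  ultimately show ?case using Suc[of k] by simp
qed

text \<open>No path of finite weight leaves a closed set, so nothing is lost by restricting the
  product to it.\<close>

lemma backward_prod_closed:
  assumes "finite S'" "S \<subseteq> S'" "i \<in> S" "j \<in> S'" and s: "no_top s"
    and closed: "\<And>n k l. k \<in> S \<Longrightarrow> l \<in> S' - S \<Longrightarrow> s n k l = -\<infinity>"
  shows "backward_prod S' s n i j \<le> (if j \<in> S then backward_prod S s n i j else -\<infinity>)"
  using assms(4)
proof (induction n arbitrary: j)
  case 0 then show ?case using assms(3) by (auto simp: mp_one_def)
next
  case (Suc n)
  have fS: "finite S" "S \<noteq> {}" "S' \<noteq> {}" using assms(2-4) finite_subset[OF assms(2,1)] by auto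
  obtain k where k: "k \<in> S'" "backward_prod S' s (Suc n) i j = backward_prod S' s n i k + s (- int (Suc n)) k j"
    using mp_mult_witness[OF assms(1) fS(3)] by (metis backward_prod.simps(2))
  have nt: "s (- int (Suc n)) k j \<noteq> \<infinity>" using s unfolding no_top_def by blast
  show ?case
  proof (cases "k \<in> S")
    case False
    then have "backward_prod S' s (Suc n) i j = -\<infinity>"
      using Suc.IH[OF k(1)] nt unfolding k(2) by simp
    then show ?thesis by simp
  next
    case True
    then have le: "backward_prod S' s (Suc n) i j \<le> backward_prod S s n i k + s (- int (Suc n)) k j"
      using Suc.IH[OF k(1)] unfolding k(2) by (simp add: add_right_mono)
    show ?thesis
    proof (cases "j \<in> S")
      case True
      have "backward_prod S s n i k + s (- int (Suc n)) k j \<le> backward_prod S s (Suc n) i j"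
        unfolding backward_prod.simps by (rule mp_mult_ge[OF fS(1) \<open>k \<in> S\<close>])
      with le show ?thesis unfolding if_P[OF True] by (rule order_trans)
    next
      case False
      then have "s (- int (Suc n)) k j = -\<infinity>" using \<open>k \<in> S\<close> Suc.prems by (intro closed) auto
      then have "backward_prod S s n i k + s (- int (Suc n)) k j = -\<infinity>"
        using backward_prod_no_top[OF fS(1,2) s, of n i k] by simp
      with le show ?thesis unfolding if_not_P[OF False] by (rule ord_le_eq_trans)
    qed
  qed
qed

text \<open>With no finite arc from \<open>S2\<close> back to \<open>S1\<close>, a path of finite
  weight from \<open>S1\<close> crosses at most once. The crossing arc is number \<open>u\<close>,
  counted from 0, and leaves \<open>n - Suc u\<close> arcs inside \<open>S2\<close>.\<close>

lemma backward_prod_block: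
  assumes fin: "finite S1" "finite S2" "S1 \<inter> S2 = {}" "S2 \<noteq> {}" and s: "no_top s"
    and tri: "\<And>n k l. k \<in> S2 \<Longrightarrow> l \<in> S1 \<Longrightarrow> s n k l = -\<infinity>"
    and a: "\<And>u k l. s (- int (Suc u)) k l \<le> ereal (a u)"
    and ij: "i \<in> S1" "j \<in> S1 \<union> S2"
  shows "(if j \<in> S1 then backward_prod (S1 \<union> S2) s n i j \<le> backward_prod S1 s n i j
     else n = 0 \<or> (\<exists>u<n. \<exists>k\<in>S2. backward_prod (S1 \<union> S2) s n i j \<le>
        max_backward S1 u s + ereal (a u) + backward_prod S2 ((retreat ^^ Suc u) s) (n - Suc u) k j))"
  using ij(2)
proof (induction n arbitrary: j)
  case 0 then show ?case by simp
next
  case (Suc n)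
  let ?S = "S1 \<union> S2" and ?x = "s (- int (Suc n))"
  have fS: "finite ?S" "?S \<noteq> {}" "S1 \<noteq> {}" using fin ij by auto
  obtain k where k: "k \<in> ?S" "backward_prod ?S s (Suc n) i j = backward_prod ?S s n i k + ?x k j"
    using mp_mult_witness[OF fS(1,2)] by (metis backward_prod.simps(2))
  have nt: "?x k j \<noteq> \<infinity>" using s unfolding no_top_def by blast
  have ntB: "backward_prod ?S s n i k \<noteq> \<infinity>" by (rule backward_prod_no_top[OF fS(1,2) s])
  consider "k \<in> S1" "j \<in> S1" | "k \<in> S2" "j \<in> S1" | "k \<in> S1" "j \<in> S2" | "k \<in> S2" "j \<in> S2"
    using k(1) Suc.prems by blast
  then show ?case
  proof cases
    case 1
    have "backward_prod ?S s (Suc n) i j \<le> backward_prod S1 s n i k + ?x k j"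
      using Suc.IH[OF k(1)] 1 unfolding k(2) by (simp add: add_right_mono)
    also have "\<dots> \<le> backward_prod S1 s (Suc n) i j"
      unfolding backward_prod.simps by (rule mp_mult_ge[OF fin(1) 1(1)])
    finally show ?thesis using 1 by simp
  next
    case 2
    then have "backward_prod ?S s (Suc n) i j = -\<infinity>"
      using tri ntB unfolding k(2) by simp
    then show ?thesis using 2 by (simp del: backward_prod.simps)
  next
    case 3
    have "backward_prod ?S s n i k \<le> backward_prod S1 s n i k" using Suc.IH[OF k(1)] 3 by simp
    also have "\<dots> \<le> max_backward S1 n s" by (rule max_entry_ge[OF fin(1) ij(1) 3(1)])
    finally have "backward_prod ?S s (Suc n) i j \<le> max_backward S1 n s + ereal (a n)"
      unfolding k(2) by (intro add_mono a)
    \<comment> \<open>The path crosses on its last arc: the remaining product is empty and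
      contributes the diagonal value 0.\<close>
    also have "\<dots> = max_backward S1 n s + ereal (a n) + backward_prod S2 ((retreat ^^ Suc n) s) (Suc n - Suc n) j j"
      by (simp add: mp_one_def)
    finally have le: "backward_prod ?S s (Suc n) i j \<le> max_backward S1 n s + ereal (a n)
        + backward_prod S2 ((retreat ^^ Suc n) s) (Suc n - Suc n) j j" .
    have j: "j \<notin> S1" using 3 fin by auto
    show ?thesis
      unfolding if_not_P[OF j] by (rule disjI2, rule exI[of _ n], rule conjI, simp, rule bexI[of _ j], rule le, rule 3(2))
  next
    case 4
    then have j: "j \<notin> S1" "k \<notin> S1" using fin by auto
    show ?thesis
    proof (cases "n = 0")
      case True
      \<comment> \<open>The empty product has no finite entry from \<open>S1\<close> to
        \<open>S2\<close>, so the bound is trivial and \<open>u = 0\<close> serves as a formal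
        witness.\<close>
      then have "backward_prod ?S s (Suc n) i j = -\<infinity>"
        using nt j ij(1) unfolding k(2) by (simp add: mp_one_def) (metis)
      then have le: "backward_prod ?S s (Suc n) i j \<le> max_backward S1 0 s + ereal (a 0)
          + backward_prod S2 ((retreat ^^ Suc 0) s) (Suc n - Suc 0) k j" by simp
      show ?thesis
        unfolding if_not_P[OF j(1)] by (rule disjI2, rule exI[of _ 0], rule conjI, simp, rule bexI[of _ k], rule le, rule 4(1))
    next
      case False
      then obtain u p where u: "u < n" "p \<in> S2" "backward_prod ?S s n i k \<le>
        max_backward S1 u s + ereal (a u) + backward_prod S2 ((retreat ^^ Suc u) s) (n - Suc u) p k"
        using Suc.IH[OF k(1)] unfolding if_not_P[OF j(2)] by blast
      \<comment> \<open>The matrix added at absolute time \<open>- Suc n\<close> has to be read as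
        the next one of the trajectory already moved by \<open>Suc u\<close>.\<close>
      have x: "?x = (retreat ^^ Suc u) s (- int (Suc (n - Suc u)))"
      proof -
        have "- int (Suc n) = - int (Suc (n - Suc u)) - int (Suc u)" using u(1) by linarith
        then show ?thesis unfolding retreat_iter by (rule arg_cong[where f=s])
      qed
      have "backward_prod ?S s (Suc n) i j \<le> max_backward S1 u s + ereal (a u)
          + (backward_prod S2 ((retreat ^^ Suc u) s) (n - Suc u) p k + ?x k j)"
        unfolding k(2) using add_right_mono[OF u(3), of "?x k j"] unfolding add.assoc .
      also have "\<dots> \<le> max_backward S1 u s + ereal (a u)
          + backward_prod S2 ((retreat ^^ Suc u) s) (Suc (n - Suc u)) p j"
        unfolding x backward_prod.simps by (intro add_left_mono mp_mult_ge fin 4)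
      also have "Suc (n - Suc u) = Suc n - Suc u" using u(1) by simp
      finally have le: "backward_prod ?S s (Suc n) i j \<le> max_backward S1 u s + ereal (a u)
          + backward_prod S2 ((retreat ^^ Suc u) s) (Suc n - Suc u) p j" .
      show ?thesis
        unfolding if_not_P[OF j(1)]
        by (rule disjI2, rule exI[of _ u], rule conjI[OF less_SucI[OF u(1)]], rule bexI[of _ p], rule le, rule u(2))
    qed
  qed
qed

section \<open>Stationary ergodic sequences of matrices\<close>

text \<open>The Borel structure on matrices comes from the product topology on functions, for which
  evaluation at an index is continuous.\<close>

lemma entry_measurable [measurable]:
  "(\<lambda>s :: int \<Rightarrow> ('d::finite) mp_mat. s n i j) \<in> borel_measurable path_space"
proof -
  have "(\<lambda>X :: 'd mp_mat. X i) \<in> borel_measurable borel" "(\<lambda>v :: 'd mp_vec. v j) \<in> borel_measurable borel"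
    by (intro borel_measurable_continuous_onI continuous_on_product_coordinates)+
  then have "(\<lambda>X :: 'd mp_mat. X i j) \<in> borel_measurable borel" by (rule measurable_compose)
  moreover have "(\<lambda>s :: int \<Rightarrow> 'd mp_mat. s n) \<in> measurable path_space borel"
    by (rule measurable_component_singleton) simp
  ultimately show ?thesis by (rule measurable_compose[rotated])
qed

lemma max_entry_measurable [measurable]:
  assumes "finite S" and [measurable]: "\<And>i j. (\<lambda>w. X w i j) \<in> borel_measurable M"
  shows "(\<lambda>w. max_entry S (X w)) \<in> borel_measurable M"
  unfolding max_entry_def using assms(1)
  by (intro borel_measurable_Max) (auto simp: case_prod_beta)

lemma backward_prod_measurable [measurable]:
  "finite S \<Longrightarrow> (\<lambda>s :: int \<Rightarrow> ('d::finite) mp_mat. backward_prod S s n i j) \<in> borel_measurable path_space"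
proof (induction n arbitrary: i j)
  case (Suc n)
  then show ?case unfolding backward_prod.simps mp_mult_def
    by (intro borel_measurable_Max borel_measurable_ereal_add entry_measurable) auto
qed simp

lemma forward_prod_measurable [measurable]:
  "finite S \<Longrightarrow> (\<lambda>s :: int \<Rightarrow> ('d::finite) mp_mat. forward_prod S s n i j) \<in> borel_measurable path_space"
proof (induction n arbitrary: i j)
  case (Suc n)
  then show ?case unfolding forward_prod.simps mp_mult_def
    by (intro borel_measurable_Max borel_measurable_ereal_add entry_measurable) auto
qed simp

lemma advance_measurable: "advance \<in> measurable path_space path_space"
  unfolding advance_def by (rule measurable_PiM_single') (auto simp: space_PiM)

lemma retreat_measurable: "retreat \<in> measurable path_space path_space"
  unfolding retreat_def by (rule measurable_PiM_single') (auto simp: space_PiM)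

text \<open>The coordinates of x(n,0) and, below, of y(n,0) as functions of the bare trajectory, so
  that the shifts can act on them.\<close>

definition xrow :: "nat \<Rightarrow> 'd::finite \<Rightarrow> (int \<Rightarrow> 'd mp_mat) \<Rightarrow> ereal" where
  "xrow n i s = mp_apply UNIV (forward_prod UNIV s n) (\<lambda>_. 0) i"

definition yrow :: "nat \<Rightarrow> 'd::finite \<Rightarrow> (int \<Rightarrow> 'd mp_mat) \<Rightarrow> ereal" where
  "yrow n i s = mp_apply UNIV (backward_prod UNIV s n) (\<lambda>_. 0) i"

lemma yrow_ge: "backward_prod UNIV s n i j \<le> yrow n i s"
  unfolding yrow_def mp_apply_def by (intro Max_ge) auto

lemma xrow_ge: "forward_prod UNIV s n i j \<le> xrow n i s"
  unfolding xrow_def mp_apply_def by (intro Max_ge) auto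

lemma yrow_witness: obtains j where "yrow n i s = backward_prod UNIV s n i j"
proof -
  have "yrow n i s \<in> range (\<lambda>j. backward_prod UNIV s n i j + 0)"
    unfolding yrow_def mp_apply_def by (intro Max_in) auto
  then show thesis by (auto intro: that)
qed

lemma xrow_witness: obtains j where "xrow n i s = forward_prod UNIV s n i j"
proof -
  have "xrow n i s \<in> range (\<lambda>j. forward_prod UNIV s n i j + 0)"
    unfolding xrow_def mp_apply_def by (intro Max_in) auto
  then show thesis by (auto intro: that)
qed

lemma xrow_measurable [measurable]: "xrow n i \<in> borel_measurable path_space"
  unfolding xrow_def[abs_def] mp_apply_def by (intro borel_measurable_Max) auto

lemma yrow_measurable [measurable]: "yrow n i \<in> borel_measurable path_space"
  unfolding yrow_def[abs_def] mp_apply_def by (intro borel_measurable_Max) auto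

lemma yrow_eq_xrow: "no_top s \<Longrightarrow> yrow n i s = xrow n i ((retreat ^^ n) s)"
  unfolding yrow_def xrow_def mp_apply_def
  by (intro arg_cong[where f=Max] image_cong refl) (simp add: backward_eq_forward)

lemma yrow_Suc_ge:
  assumes "no_top s" shows "s (-1) i k + yrow n k (retreat s) \<le> yrow (Suc n) i s"
proof -
  obtain j where j: "yrow n k (retreat s) = backward_prod UNIV (retreat s) n k j" by (rule yrow_witness)
  have "s (-1) i k + backward_prod UNIV (retreat s) n k j \<le> mp_mult UNIV (s (-1)) (backward_prod UNIV (retreat s) n) i j"
    by (rule mp_mult_ge) auto
  also have "\<dots> = backward_prod UNIV s (Suc n) i j"
    using assms by (subst backward_prod_Suc_left) auto
  also have "\<dots> \<le> yrow (Suc n) i s" by (rule yrow_ge)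
  finally show ?thesis unfolding j .
qed

lemma yrow_Suc_witness:
  assumes "no_top s"
  obtains k where "yrow (Suc n) i s = s (-1) i k + yrow n k (retreat s)"
proof -
  obtain j where j: "yrow (Suc n) i s = backward_prod UNIV s (Suc n) i j" by (rule yrow_witness)
  also have "\<dots> = mp_mult UNIV (s (-1)) (backward_prod UNIV (retreat s) n) i j"
    using assms by (subst backward_prod_Suc_left) auto
  finally obtain k where "yrow (Suc n) i s = s (-1) i k + backward_prod UNIV (retreat s) n k j"
    using mp_mult_witness[of UNIV] by (metis finite UNIV_not_empty)
  then have "yrow (Suc n) i s \<le> s (-1) i k + yrow n k (retreat s)"
    using add_left_mono[OF yrow_ge] by metis
  then have "yrow (Suc n) i s = s (-1) i k + yrow n k (retreat s)"
    using yrow_Suc_ge[OF assms] by (rule antisym)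
  then show thesis by (rule that)
qed

lemma xrow_Suc_ge: "s (int n) i k + xrow n k s \<le> xrow (Suc n) i s"
proof -
  obtain j where j: "xrow n k s = forward_prod UNIV s n k j" by (rule xrow_witness)
  have "s (int n) i k + forward_prod UNIV s n k j \<le> forward_prod UNIV s (Suc n) i j"
    unfolding forward_prod.simps by (rule mp_mult_ge) auto
  also have "\<dots> \<le> xrow (Suc n) i s" by (rule xrow_ge)
  finally show ?thesis unfolding j .
qed

text \<open>Further matrices extend the path at its far end and the row \<open>i\<close> is kept.
  This bounds the increments in time, as \<open>reversed_lower\<close> demands.\<close>

lemma yrow_split: "yrow (n + m) i s \<le> yrow n i s + max_backward UNIV m ((retreat ^^ n) s)"
proof -
  obtain j where j: "yrow (n + m) i s = backward_prod UNIV s (n + m) i j" by (rule yrow_witness)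
  obtain k where "backward_prod UNIV s (n + m) i j \<le> backward_prod UNIV s n i k + backward_prod UNIV ((retreat ^^ n) s) m k j"
    using backward_prod_split[of UNIV i j s n m] by auto
  also have "\<dots> \<le> yrow n i s + max_backward UNIV m ((retreat ^^ n) s)"
    by (intro add_mono yrow_ge max_entry_ge) auto
  finally show ?thesis unfolding j .
qed

text \<open>In contrast to \<open>yrow_split\<close>, the row \<open>i\<close> survives in the later
  factor, that is, after shifting the trajectory. The case \<open>n = 1\<close> gives the zero-one
  law for the growth of x.\<close>

lemma xrow_split: "xrow (n + m) i s \<le> max_forward UNIV n s + xrow m i ((advance ^^ n) s)"
proof -
  obtain j where j: "xrow (n + m) i s = forward_prod UNIV s (n + m) i j" by (rule xrow_witness)
  obtain k where "forward_prod UNIV s (n + m) i j \<le> forward_prod UNIV ((advance ^^ n) s) m i k + forward_prod UNIV s n k j"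
    using forward_prod_split[of UNIV i j s n m] by auto
  also have "\<dots> \<le> xrow m i ((advance ^^ n) s) + max_forward UNIV n s"
    by (intro add_mono xrow_ge max_entry_ge) auto
  finally show ?thesis unfolding j by (simp add: add.commute)
qed

lemma sum_orbit_shift:
  fixes g :: "'b \<Rightarrow> real"
  shows "(\<Sum>j<l. g ((T ^^ j) ((T ^^ k) x))) = (\<Sum>j\<in>{k..<k+l}. g ((T ^^ j) x))"
  using sum.shift_bounds_nat_ivl[of "\<lambda>j. g ((T ^^ j) x)" 0 k l]
  by (simp add: atLeast0LessThan add.commute funpow_add)

section \<open>Stationary ergodic laws on the space of trajectories\<close>

locale mp_system = prob_space P for P :: "(int \<Rightarrow> ('d::finite) mp_mat) measure" +
  assumes sets_P [measurable_cong]: "sets P = sets path_space"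
    and stat: "distr P P advance = P"
    and erg: "\<And>B. B \<in> sets path_space \<Longrightarrow> advance -` B = B \<Longrightarrow> prob B \<in> {0, 1}"
    and AE_no_top: "AE s in P. no_top s"
    and integ: "integrable P (\<lambda>s. real_of_ereal (max 0 (max_entry UNIV (s 0))))"
begin

lemma space_P [simp]: "space P = UNIV"
  using sets_eq_imp_space_eq[OF sets_P] by (simp add: space_PiM)

lemma advance_meas [measurable]: "advance \<in> measurable P P"
  using advance_measurable by (simp cong: measurable_cong_sets add: sets_P)

lemma retreat_meas [measurable]: "retreat \<in> measurable P P"
  using retreat_measurable by (simp cong: measurable_cong_sets add: sets_P)

lemma stat_retreat: "distr P P retreat = P"
proof -
  have "distr P P retreat = distr (distr P P advance) P retreat" by (simp only: stat)
  also have "\<dots> = distr P P (retreat \<circ> advance)" by (rule distr_distr) measurable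
  also have "\<dots> = distr P P id" by (intro distr_cong) auto
  finally show ?thesis by (simp add: distr_id id_def)
qed

sublocale fwd: ergodic_map P advance
  by unfold_locales (use stat erg in \<open>auto simp: sets_P\<close>)

sublocale bwd: ergodic_map P retreat
proof unfold_locales
  fix B assume B: "B \<in> sets P" "retreat -` B \<inter> space P = B"
  have "advance -` B = advance -` (retreat -` B)" using B(2) by simp
  also have "\<dots> = B" by (auto simp: vimage_def)
  finally show "prob B \<in> {0, 1}" using B(1) erg sets_P by blast
qed (auto simp: stat_retreat)

text \<open>The integrable majorant needed by the ergodic theorems. The cut at 0 makes it real
  valued and nonnegative even if all entries are -\<infinity>.\<close>

definition peak :: "(int \<Rightarrow> 'd mp_mat) \<Rightarrow> real" where
  "peak s = real_of_ereal (max 0 (max_entry UNIV (s 0)))"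

lemma peak_nonneg: "0 \<le> peak s" by (simp add: peak_def real_of_ereal_pos)

lemma integrable_peak: "integrable P peak" using integ unfolding peak_def .

text \<open>Backward products begin with the matrix at time -1, so their majorant is
  \<open>peak\<close> after one retreat.\<close>

lemma integrable_peak_retreat: "integrable P (\<lambda>s. peak (retreat s))"
  using bwd.integrable_iter[OF integrable_peak, of 1] by simp

lemma entry_le_peak:
  assumes "no_top s" shows "s 0 i j \<le> ereal (peak s)"
proof -
  obtain k l where "max_entry UNIV (s 0) = s 0 k l"
    using max_entry_witness[of UNIV "s 0"] by auto
  then have "max 0 (max_entry UNIV (s 0)) \<noteq> \<infinity>"
    using assms by (auto simp: no_top_def max_def)
  then have "ereal (peak s) = max 0 (max_entry UNIV (s 0))"
    unfolding peak_def by (auto simp: ereal_real' max_def split: if_splits)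
  moreover have "s 0 i j \<le> max_entry UNIV (s 0)" by (rule max_entry_ge) auto
  ultimately show ?thesis by (simp add: le_max_iff_disj)
qed

lemma entry_le_peak_retreat:
  "no_top s \<Longrightarrow> s (- int (Suc u)) i j \<le> ereal (peak (retreat ((retreat ^^ u) s)))"
  using entry_le_peak[OF no_top_iter(2), of s "Suc u" i j]
  by (simp add: retreat_iter retreat_def algebra_simps)

lemma max_backward_one_le_peak:
  assumes "no_top s" "S \<noteq> {}"
  shows "max_backward S 1 s \<le> ereal (peak (retreat s))"
proof -
  obtain i j where "i \<in> S" "max_backward S 1 s = backward_prod S s 1 i j"
    using max_entry_witness[OF finite assms(2)] by metis
  then have "max_backward S 1 s = s (-1) i j"
    using backward_prod_1[OF finite _ assms(1)] by metis
  then show ?thesis using entry_le_peak_retreat[OF assms(1), of 0 i j] by simp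
qed

lemma max_backward_le_peak:
  assumes "no_top s" "S \<noteq> {}"
  shows "max_backward S n s \<le> ereal (\<Sum>k<n. peak (retreat ((retreat ^^ k) s)))"
proof (induction n)
  case 0 then show ?case using assms(2) by (simp add: max_entry_mp_one zero_ereal_def)
next
  case (Suc n)
  have "max_backward S (n + 1) s \<le> max_backward S n s + max_backward S 1 ((retreat ^^ n) s)"
    using assms(2) by (intro max_backward_subadd) auto
  also have "\<dots> \<le> ereal (\<Sum>k<n. peak (retreat ((retreat ^^ k) s))) + ereal (peak (retreat ((retreat ^^ n) s)))"
    by (intro add_mono Suc max_backward_one_le_peak no_top_iter assms)
  finally show ?case by (simp only: Suc_eq_plus1[symmetric] sum.lessThan_Suc plus_ereal.simps)
qed

lemma max_forward_one_le_peak: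
  assumes "no_top s" "S \<noteq> {}"
  shows "max_forward S 1 s \<le> ereal (peak s)"
proof -
  obtain i j where "j \<in> S" "max_forward S 1 s = forward_prod S s 1 i j"
    using max_entry_witness[OF finite assms(2)] by metis
  then have "max_forward S 1 s = s 0 i j"
    using forward_prod_1[OF finite _ assms(1)] by metis
  then show ?thesis using entry_le_peak[OF assms(1), of i j] by simp
qed

lemma max_forward_le_peak:
  assumes "no_top s" "S \<noteq> {}"
  shows "max_forward S n s \<le> ereal (\<Sum>k<n. peak ((advance ^^ k) s))"
proof (induction n)
  case 0 then show ?case using assms(2) by (simp add: max_entry_mp_one zero_ereal_def)
next
  case (Suc n)
  have "max_forward S (n + 1) s \<le> max_forward S n s + max_forward S 1 ((advance ^^ n) s)"
    using assms(2) by (intro max_forward_subadd) auto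
  also have "\<dots> \<le> ereal (\<Sum>k<n. peak ((advance ^^ k) s)) + ereal (peak ((advance ^^ n) s))"
    by (intro add_mono Suc max_forward_one_le_peak no_top_iter assms)
  finally show ?case by (simp only: Suc_eq_plus1[symmetric] sum.lessThan_Suc plus_ereal.simps)
qed

text \<open>Defined through backward products; that forward products have the same rate is proved in
  \<open>forward_kingman\<close>.\<close>

definition exponent :: "'d set \<Rightarrow> ereal" where
  "exponent S = bwd.drift (max_backward S)"

lemma max_backward_measurable [measurable]: "max_backward S n \<in> borel_measurable P"
  by measurable

lemma max_forward_measurable [measurable]: "max_forward S n \<in> borel_measurable P"
  by measurable

lemma backward_kingman:
  assumes "S \<noteq> {}"
  shows "exponent S \<noteq> \<infinity>" "AE s in P. (\<lambda>n. max_backward S n s / ereal (real n)) \<longlonglongrightarrow> exponent S"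
    "\<And>b e. exponent S < ereal b \<Longrightarrow> 0 < e \<Longrightarrow>
       AE s in P. \<exists>C. \<forall>u l. max_backward S l ((retreat ^^ u) s) \<le> ereal (b * real l + e * real (u + l) + C)"
proof -
  have sub: "AE s in P. \<forall>n m. max_backward S (n + m) s \<le> max_backward S n s + max_backward S m ((retreat ^^ n) s)"
    using assms by (simp add: max_backward_subadd)
  have zero: "AE s in P. max_backward S 0 s \<le> 0" using assms by (simp add: max_entry_mp_one)
  have one: "AE s in P. max_backward S 1 s \<le> ereal (peak (retreat s))"
    using AE_no_top by eventually_elim (rule max_backward_one_le_peak[OF _ assms])
  note * = max_backward_measurable integrable_peak_retreat sub zero one
  show "exponent S \<noteq> \<infinity>" "AE s in P. (\<lambda>n. max_backward S n s / ereal (real n)) \<longlonglongrightarrow> exponent S"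
    unfolding exponent_def by (rule bwd.subadditive_ergodic[OF *])+
  show "\<And>b e. exponent S < ereal b \<Longrightarrow> 0 < e \<Longrightarrow>
       AE s in P. \<exists>C. \<forall>u l. max_backward S l ((retreat ^^ u) s) \<le> ereal (b * real l + e * real (u + l) + C)"
    unfolding exponent_def by (rule bwd.subadditive_uniform_upper[OF *])
qed

lemma limit_ge_eventual_bound:
  assumes "AE s in P. \<forall>\<^sub>F n in sequentially. ereal (c * real n) \<le> u n s"
    and "AE s in P. (\<lambda>n. u n s / ereal (real n)) \<longlonglongrightarrow> g"
  shows "ereal c \<le> g"
proof -
  have "AE s in P. ereal c \<le> g"
    using assms
  proof eventually_elim
    case (elim s)
    have "\<forall>\<^sub>F n in sequentially. ereal c \<le> u n s / ereal (real n)"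
      using elim(1) eventually_gt_at_top[of 0]
      by eventually_elim (simp add: ereal_le_divide_pos mult.commute)
    then show ?case using tendsto_lowerbound[OF elim(2)] by simp
  qed
  then show ?thesis by simp
qed

text \<open>Kingman's theorem over \<open>advance\<close> gives a limit that could a priori differ
  from \<open>exponent S\<close>. Each of the two maxima is the reversal of the other, so
  \<open>reversed_lower\<close>, used once over each shift, yields both inequalities.\<close>

lemma forward_kingman:
  assumes "S \<noteq> {}"
  shows "AE s in P. (\<lambda>n. max_forward S n s / ereal (real n)) \<longlonglongrightarrow> exponent S"
proof -
  have sub: "AE s in P. \<forall>n m. max_forward S (n + m) s \<le> max_forward S n s + max_forward S m ((advance ^^ n) s)"
    using assms by (simp add: max_forward_subadd)
  have zero: "AE s in P. max_forward S 0 s \<le> 0" using assms by (simp add: max_entry_mp_one)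
  have one: "AE s in P. max_forward S 1 s \<le> ereal (peak s)"
    using AE_no_top by eventually_elim (rule max_forward_one_le_peak[OF _ assms])
  let ?d = "fwd.drift (max_forward S)"
  have lim: "AE s in P. (\<lambda>n. max_forward S n s / ereal (real n)) \<longlonglongrightarrow> ?d"
    by (rule fwd.subadditive_ergodic[OF max_forward_measurable integrable_peak sub zero one])
  have "?d \<le> exponent S"
  proof (rule ccontr)
    assume "\<not> ?thesis"
    then have "exponent S < ?d" by simp
    then obtain c where c: "exponent S < ereal c" "ereal c < ?d" by (rule ereal_dense2[THEN exE]) blast
    then obtain b where b: "c < b" "ereal b < ?d" using ereal_dense2[OF c(2)] by auto
    have "AE s in P. \<forall>\<^sub>F n in sequentially. ereal (c * real n) \<le> max_backward S n s"
    proof (rule bwd.reversed_lower[where f="max_forward S" and a="\<lambda>s. peak (retreat s)" and b=b])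
      show "AE s in P. \<forall>\<^sub>F n in sequentially. ereal (b * real n) \<le> max_forward S n s"
        using b(2) by (intro fwd.AE_ge_below_drift max_forward_measurable)
      show "AE s in P. \<forall>n. max_backward S n s = max_forward S n ((retreat ^^ n) s)"
        using AE_no_top by eventually_elim (simp add: max_backward_eq_forward(1))
      show "AE s in P. \<forall>k l. max_backward S (k + l) s \<le> max_backward S k s + ereal (\<Sum>j\<in>{k..<k+l}. peak (retreat ((retreat ^^ j) s)))"
        using AE_no_top
      proof eventually_elim
        case (elim s)
        show ?case
        proof (intro allI)
          fix k l
          have "max_backward S (k + l) s \<le> max_backward S k s + max_backward S l ((retreat ^^ k) s)"
            by (rule max_backward_subadd[OF finite assms])
          also have "\<dots> \<le> max_backward S k s + ereal (\<Sum>j<l. peak (retreat ((retreat ^^ j) ((retreat ^^ k) s))))"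
            by (intro add_left_mono max_backward_le_peak no_top_iter elim assms)
          finally show "max_backward S (k + l) s \<le> max_backward S k s + ereal (\<Sum>j\<in>{k..<k+l}. peak (retreat ((retreat ^^ j) s)))"
            unfolding sum_orbit_shift[of "\<lambda>s. peak (retreat s)"] .
        qed
      qed
    qed (rule max_forward_measurable integrable_peak_retreat peak_nonneg b(1))+
    then have "ereal c \<le> exponent S" using backward_kingman(2)[OF assms] by (rule limit_ge_eventual_bound)
    with c show False by simp
  qed
  moreover have "?d \<ge> exponent S"
  proof (rule ccontr)
    assume "\<not> ?thesis"
    then have "?d < exponent S" by simp
    then obtain c where c: "?d < ereal c" "ereal c < exponent S" by (rule ereal_dense2[THEN exE]) blast
    then obtain b where b: "c < b" "ereal b < exponent S" using ereal_dense2[OF c(2)] by auto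
    have "AE s in P. \<forall>\<^sub>F n in sequentially. ereal (c * real n) \<le> max_forward S n s"
    proof (rule fwd.reversed_lower[where f="max_backward S" and a=peak and b=b])
      show "AE s in P. \<forall>\<^sub>F n in sequentially. ereal (b * real n) \<le> max_backward S n s"
        using b(2) unfolding exponent_def by (intro bwd.AE_ge_below_drift max_backward_measurable)
      show "AE s in P. \<forall>n. max_forward S n s = max_backward S n ((advance ^^ n) s)"
        using AE_no_top by eventually_elim (simp add: max_backward_eq_forward(2))
      show "AE s in P. \<forall>k l. max_forward S (k + l) s \<le> max_forward S k s + ereal (\<Sum>j\<in>{k..<k+l}. peak ((advance ^^ j) s))"
        using AE_no_top
      proof eventually_elim
        case (elim s)
        show ?case
        proof (intro allI)
          fix k l
          have "max_forward S (k + l) s \<le> max_forward S k s + max_forward S l ((advance ^^ k) s)"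
            by (rule max_forward_subadd[OF finite assms])
          also have "\<dots> \<le> max_forward S k s + ereal (\<Sum>j<l. peak ((advance ^^ j) ((advance ^^ k) s)))"
            by (intro add_left_mono max_forward_le_peak no_top_iter elim assms)
          finally show "max_forward S (k + l) s \<le> max_forward S k s + ereal (\<Sum>j\<in>{k..<k+l}. peak ((advance ^^ j) s))"
            unfolding sum_orbit_shift[of peak] .
        qed
      qed
    qed (rule max_backward_measurable integrable_peak peak_nonneg b(1))+
    then have "ereal c \<le> ?d" using lim by (rule limit_ge_eventual_bound)
    with c show False by simp
  qed
  ultimately have "?d = exponent S" by (rule antisym)
  with lim show ?thesis by (rule subst[rotated])
qed

lemma limit_le_eventual_bound:
  assumes "AE s in P. \<forall>\<^sub>F n in sequentially. u n s \<le> ereal (c * real n)"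
    and "AE s in P. (\<lambda>n. u n s / ereal (real n)) \<longlonglongrightarrow> g"
  shows "g \<le> ereal c"
proof -
  have "AE s in P. g \<le> ereal c"
    using assms
  proof eventually_elim
    case (elim s)
    have "\<forall>\<^sub>F n in sequentially. u n s / ereal (real n) \<le> ereal c"
      using elim(1) eventually_gt_at_top[of 0]
      by eventually_elim (simp add: ereal_divide_le_pos mult.commute)
    then show ?case using tendsto_upperbound[OF elim(2)] by simp
  qed
  then show ?thesis by simp
qed

text \<open>A path consists of a piece in one block, one crossing arc and a piece in the other
  block. The crossing time is uncontrolled, hence the uniform bounds; the crossing arc itself grows
  sublinearly by Birkhoff.\<close>

lemma exponent_block:
  assumes S: "S1 \<noteq> {}" "S2 \<noteq> {}" "S1 \<inter> S2 = {}"
    and tri: "AE s in P. \<forall>n. \<forall>k\<in>S2. \<forall>l\<in>S1. s n k l = -\<infinity>"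
  shows "exponent (S1 \<union> S2) \<le> max (exponent S1) (exponent S2)"
proof (rule ccontr)
  assume "\<not> ?thesis"
  then have "max (exponent S1) (exponent S2) < exponent (S1 \<union> S2)" by (simp only: not_le)
  then obtain d where d: "max (exponent S1) (exponent S2) < ereal d" "ereal d < exponent (S1 \<union> S2)"
    by (rule ereal_dense2[THEN exE]) blast
  from d(1) obtain b where b: "max (exponent S1) (exponent S2) < ereal b" "ereal b < ereal d"
    by (rule ereal_dense2[THEN exE]) blast
  \<comment> \<open>The errors add up to at most \<open>4 * e\<close> per step: one \<open>e\<close>
    for the piece in \<open>S1\<close>, two for the crossing arc, one for the piece in
    \<open>S2\<close>. With an eighth of the gap, \<open>b + 4 * e\<close> is the midpoint of
    \<open>b\<close> and \<open>d\<close>.\<close>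
  define e where "e = (d - b) / 8"
  have e: "e > 0" "b + 4 * e < d" using b(2) by (simp_all add: e_def field_simps)
  define E where "E = (LINT s|P. peak (retreat s))"
  have b1: "exponent S1 < ereal b" and b2: "exponent S2 < ereal b" using b(1) by auto
  have "AE s in P. \<forall>\<^sub>F n in sequentially. max_backward (S1 \<union> S2) n s \<le> ereal (d * real n)"
    using backward_kingman(3)[OF S(1) b1 e(1)] backward_kingman(3)[OF S(2) b2 e(1)]
      bwd.birkhoff_bounds[OF integrable_peak_retreat e(1)] AE_no_top tri
  proof eventually_elim
    case (elim s)
    obtain C1 where C1: "\<And>u l. max_backward S1 l ((retreat ^^ u) s) \<le> ereal (b * real l + e * real (u + l) + C1)"
      using elim(1) by blast
    obtain C2 where C2: "\<And>u l. max_backward S2 l ((retreat ^^ u) s) \<le> ereal (b * real l + e * real (u + l) + C2)"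
      using elim(2) by blast
    obtain C3 where C3: "C3 \<ge> 0" "\<And>n. \<bar>(\<Sum>k<n. peak (retreat ((retreat ^^ k) s))) - E * real n\<bar> \<le> e * real n + C3"
      using elim(3) unfolding E_def by blast
    define p where "p u = peak (retreat ((retreat ^^ u) s))" for u
    \<comment> \<open>A single summand is the difference of consecutive orbit sums, which leaves an
      error of order \<open>e * real u\<close>.\<close>
    have p: "p u \<le> E + e * (2 * real u + 1) + 2 * C3" for u
      using C3(2)[of u] C3(2)[of "Suc u"] unfolding p_def by (simp add: algebra_simps)
    define K where "K = \<bar>C1\<bar> + \<bar>C2\<bar> + 2 * C3 + \<bar>E\<bar> + \<bar>b\<bar> + e"
    have main: "max_backward (S1 \<union> S2) n s \<le> ereal ((b + 4 * e) * real n + K)" if n: "n > 0" for n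
    proof -
      have bound: "ereal (b * real n + e * real (0 + n) + C) \<le> ereal ((b + 4 * e) * real n + K)"
        if "C = C1 \<or> C = C2" for C
      proof -
        have "C \<le> K" using that C3(1) e(1) unfolding K_def by auto
        moreover have "0 \<le> e * real n" using e(1) by simp
        ultimately show ?thesis by (simp add: algebra_simps)
      qed
      obtain i j where ij: "i \<in> S1 \<union> S2" "j \<in> S1 \<union> S2"
        "max_backward (S1 \<union> S2) n s = backward_prod (S1 \<union> S2) s n i j"
        using max_entry_witness[of "S1 \<union> S2"] S by (metis finite Un_empty)
      consider "i \<in> S2" | "i \<in> S1" "j \<in> S1" | "i \<in> S1" "j \<in> S2" "j \<notin> S1" using ij S by blast
      then show ?thesis
      proof cases
        case 1
        have "backward_prod (S1 \<union> S2) s n i j \<le> (if j \<in> S2 then backward_prod S2 s n i j else -\<infinity>)"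
          using 1 ij(2) elim(4,5) by (intro backward_prod_closed) auto
        also have "\<dots> \<le> max_backward S2 n s" using 1 by (auto intro: max_entry_ge)
        also have "\<dots> \<le> ereal (b * real n + e * real (0 + n) + C2)" using C2[of 0 n] by simp
        also have "\<dots> \<le> ereal ((b + 4 * e) * real n + K)" by (rule bound) simp
        finally show ?thesis unfolding ij(3) .
      next
        case 2
        have "backward_prod (S1 \<union> S2) s n i j \<le> backward_prod S1 s n i j"
          using backward_prod_block[of S1 S2 s p i j n] 2 S elim(4,5) entry_le_peak_retreat unfolding p_def by auto
        also have "\<dots> \<le> max_backward S1 n s" using 2 by (auto intro: max_entry_ge)
        also have "\<dots> \<le> ereal (b * real n + e * real (0 + n) + C1)" using C1[of 0 n] by simp
        also have "\<dots> \<le> ereal ((b + 4 * e) * real n + K)" by (rule bound) simp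
        finally show ?thesis unfolding ij(3) .
      next
        case 3
        have "n = 0 \<or> (\<exists>u<n. \<exists>k\<in>S2. backward_prod (S1 \<union> S2) s n i j \<le>
          max_backward S1 u s + ereal (p u) + backward_prod S2 ((retreat ^^ Suc u) s) (n - Suc u) k j)"
          using backward_prod_block[of S1 S2 s p i j n] 3 S elim(4,5) entry_le_peak_retreat
          unfolding p_def if_not_P[OF 3(3)] by auto
        then obtain u k where u: "u < n" "k \<in> S2" "backward_prod (S1 \<union> S2) s n i j \<le>
          max_backward S1 u s + ereal (p u) + backward_prod S2 ((retreat ^^ Suc u) s) (n - Suc u) k j"
          using n by auto
        define m where "m = n - Suc u"
        have m: "real n = real u + real m + 1" using u(1) unfolding m_def by simp
        note u(3)
        also have "max_backward S1 u s + ereal (p u) + backward_prod S2 ((retreat ^^ Suc u) s) (n - Suc u) k j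
          \<le> ereal (b * real u + e * real (0 + u) + C1) + ereal (p u) + ereal (b * real m + e * real (Suc u + m) + C2)"
        proof (intro add_mono order_refl)
          show "max_backward S1 u s \<le> ereal (b * real u + e * real (0 + u) + C1)" using C1[of 0 u] by simp
          have "backward_prod S2 ((retreat ^^ Suc u) s) m k j \<le> max_backward S2 m ((retreat ^^ Suc u) s)"
            using u(2) 3 by (intro max_entry_ge) auto
          also have "\<dots> \<le> ereal (b * real m + e * real (Suc u + m) + C2)" by (rule C2)
          finally show "backward_prod S2 ((retreat ^^ Suc u) s) (n - Suc u) k j
             \<le> ereal (b * real m + e * real (Suc u + m) + C2)" unfolding m_def .
        qed
        also have "\<dots> \<le> ereal ((b + 4 * e) * real n + K)"
        proof -
          have "0 \<le> e * real m" "0 \<le> e * real u" using e(1) by auto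
          moreover have "C1 \<le> \<bar>C1\<bar>" "C2 \<le> \<bar>C2\<bar>" "E \<le> \<bar>E\<bar>" "- b \<le> \<bar>b\<bar>" by auto
          ultimately show ?thesis using p[of u] C3(1) e(1) unfolding K_def m
            by (simp only: plus_ereal.simps ereal_less_eq(3) of_nat_Suc of_nat_add of_nat_0 algebra_simps)
        qed
        finally show ?thesis unfolding ij(3) .
      qed
    qed
    show ?case
      using eventually_affine_le[OF e(2), of K] eventually_gt_at_top[of 0]
    proof eventually_elim
      case (elim n)
      have "ereal ((b + 4 * e) * real n + K) \<le> ereal (d * real n)" using elim(1) by simp
      with main[OF elim(2)] show ?case by (rule order_trans)
    qed
  qed
  moreover have "AE s in P. (\<lambda>n. max_backward (S1 \<union> S2) n s / ereal (real n)) \<longlonglongrightarrow> exponent (S1 \<union> S2)"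
    using S(1) by (intro backward_kingman) auto
  ultimately have "exponent (S1 \<union> S2) \<le> ereal d" by (rule limit_le_eventual_bound)
  with d(2) show False by simp
qed

section \<open>The graph, its components and the upper bound for y\<close>

definition arc :: "'d \<Rightarrow> 'd \<Rightarrow> bool" where
  "arc i j \<longleftrightarrow> prob {s. s 0 i j \<noteq> -\<infinity>} > 0"

definition components :: "'d set set" where
  "components = {S. S \<noteq> {} \<and> (\<forall>u\<in>S. \<forall>v\<in>S. arc\<^sup>*\<^sup>* u v) \<and>
     (\<forall>u\<in>S. \<forall>v. v \<notin> S \<longrightarrow> \<not> arc\<^sup>*\<^sup>* u v \<or> \<not> arc\<^sup>*\<^sup>* v u)}"

definition top_exponent :: "'d \<Rightarrow> ereal" where
  "top_exponent i = Max (exponent ` {c \<in> components. \<exists>j\<in>c. arc\<^sup>*\<^sup>* i j})"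

lemma arc_iff_not_AE: "arc i j \<longleftrightarrow> \<not> (AE s in P. s 0 i j = -\<infinity>)"
proof -
  have [measurable]: "{s. s 0 i j \<noteq> -\<infinity>} \<in> sets P"
  proof -
    have "{s \<in> space P. s 0 i j \<noteq> -\<infinity>} \<in> sets P" by measurable
    then show ?thesis by simp
  qed
  have "(AE s in P. s 0 i j = -\<infinity>) \<longleftrightarrow> prob {s. s 0 i j \<noteq> -\<infinity>} = 0"
    by (subst prob_eq_0) auto
  then show ?thesis unfolding arc_def using measure_nonneg[of P "{s. s 0 i j \<noteq> -\<infinity>}"] by linarith
qed

lemma AE_all_times:
  assumes "AE s in P. Q (s 0)" shows "AE s in P. \<forall>n. Q (s n)"
  using fwd.AE_iter[OF assms] bwd.AE_iter[OF assms]
proof eventually_elim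
  case (elim s)
  show ?case
  proof
    fix n :: int
    show "Q (s n)"
      using elim(1)[rule_format, of "nat n"] elim(2)[rule_format, of "nat (- n)"]
      by (cases "n \<ge> 0") (auto simp: advance_iter retreat_iter)
  qed
qed

lemma AE_no_arc: "AE s in P. \<forall>n i j. \<not> arc i j \<longrightarrow> s n i j = -\<infinity>"
proof -
  have "AE s in P. \<forall>i j. \<not> arc i j \<longrightarrow> s 0 i j = -\<infinity>"
    by (simp add: AE_all_countable arc_iff_not_AE)
  then show ?thesis by (rule AE_all_times)
qed

lemma component_of: "{j. arc\<^sup>*\<^sup>* i j \<and> arc\<^sup>*\<^sup>* j i} \<in> components"
  unfolding components_def by (auto intro: rtranclp_trans)

text \<open>The second hypothesis says that \<open>S\<close> is a union of components. If
  \<open>u\<close> does not reach all of \<open>S\<close>, the nodes that \<open>u\<close> reaches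
  have no arc to the others, so \<open>exponent_block\<close> applies; both parts are again unions
  of components and smaller.\<close>

lemma exponent_le_component:
  assumes "S \<noteq> {}" "\<And>u v. u \<in> S \<Longrightarrow> arc\<^sup>*\<^sup>* u v \<Longrightarrow> arc\<^sup>*\<^sup>* v u \<Longrightarrow> v \<in> S"
  shows "\<exists>c\<in>components. c \<subseteq> S \<and> exponent S \<le> exponent c"
  using assms
proof (induction "card S" arbitrary: S rule: less_induct)
  case less
  show ?case
  proof (cases "S \<in> components")
    case True then show ?thesis by blast
  next
    case False
    then obtain u v where uv: "u \<in> S" "v \<in> S" "\<not> arc\<^sup>*\<^sup>* u v"
      using less.prems unfolding components_def by blast
    define S1 where "S1 = {j \<in> S. \<not> arc\<^sup>*\<^sup>* u j}"
    define S2 where "S2 = {j \<in> S. arc\<^sup>*\<^sup>* u j}"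
    have S: "S = S1 \<union> S2" "S1 \<inter> S2 = {}" "v \<in> S1" "u \<in> S2" using uv by (auto simp: S1_def S2_def)
    have "S1 \<subset> S" "S2 \<subset> S" using S by auto
    then have card: "card S1 < card S" "card S2 < card S" by (auto intro: psubset_card_mono)
    have sat: "q \<in> S1" if "p \<in> S1" "arc\<^sup>*\<^sup>* p q" "arc\<^sup>*\<^sup>* q p" for p q
      using that less.prems(2)[of p q] unfolding S1_def by (auto intro: rtranclp_trans)
    have sat': "q \<in> S2" if "p \<in> S2" "arc\<^sup>*\<^sup>* p q" "arc\<^sup>*\<^sup>* q p" for p q
      using that less.prems(2)[of p q] unfolding S2_def by (auto intro: rtranclp_trans)
    obtain c1 where c1: "c1 \<in> components" "c1 \<subseteq> S1" "exponent S1 \<le> exponent c1"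
      using less.hyps[OF card(1)] S(3) sat by blast
    obtain c2 where c2: "c2 \<in> components" "c2 \<subseteq> S2" "exponent S2 \<le> exponent c2"
      using less.hyps[OF card(2)] S(4) sat' by blast
    have "exponent S \<le> max (exponent S1) (exponent S2)"
      unfolding S(1)
    proof (rule exponent_block)
      show "AE s in P. \<forall>n. \<forall>k\<in>S2. \<forall>l\<in>S1. s n k l = -\<infinity>"
        using AE_no_arc
      proof eventually_elim
        case (elim s)
        have "\<not> arc k l" if "k \<in> S2" "l \<in> S1" for k l
          using that unfolding S1_def S2_def by (auto dest: rtranclp.rtrancl_into_rtrancl)
        with elim show ?case by blast
      qed
    qed (use S in auto)
    then show ?thesis using c1 c2 S(1) by (auto simp: max_def split: if_splits intro: order_trans)
  qed
qed

lemma top_exponent_ge: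
  "c \<in> components \<Longrightarrow> j \<in> c \<Longrightarrow> arc\<^sup>*\<^sup>* i j \<Longrightarrow> exponent c \<le> top_exponent i"
  unfolding top_exponent_def by (intro Max_ge) auto

lemma top_exponent_witness:
  obtains c j where "c \<in> components" "j \<in> c" "arc\<^sup>*\<^sup>* i j" "top_exponent i = exponent c"
proof -
  have "{c \<in> components. \<exists>j\<in>c. arc\<^sup>*\<^sup>* i j} \<noteq> {}" using component_of[of i] by blast
  then have "top_exponent i \<in> exponent ` {c \<in> components. \<exists>j\<in>c. arc\<^sup>*\<^sup>* i j}"
    unfolding top_exponent_def by (intro Max_in) auto
  then show thesis using that by auto
qed

text \<open>Paths from \<open>i\<close> stay in the set of nodes reachable from \<open>i\<close>,
  whose exponent is attained on a component reachable from \<open>i\<close>.\<close>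

lemma yrow_upper:
  assumes "top_exponent i < ereal b"
  shows "AE s in P. \<forall>\<^sub>F n in sequentially. yrow n i s \<le> ereal (b * real n)"
proof -
  define F where "F = {j. arc\<^sup>*\<^sup>* i j}"
  have F: "i \<in> F" "F \<noteq> {}" by (auto simp: F_def)
  obtain c where c: "c \<in> components" "c \<subseteq> F" "exponent F \<le> exponent c"
    using exponent_le_component[of F] F unfolding F_def by (auto intro: rtranclp_trans)
  obtain j where j: "j \<in> c" using c(1) by (auto simp: components_def)
  have "exponent c \<le> top_exponent i" using c j by (intro top_exponent_ge[of c j]) (auto simp: F_def)
  then have "exponent F < ereal b" using c(3) assms by simp
  show ?thesis
    using backward_kingman(2)[OF F(2)] AE_no_top AE_no_arc
  proof eventually_elim
    case (elim s)
    have "\<forall>\<^sub>F n in sequentially. max_backward F n s \<le> ereal (b * real n)"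
      using elim(1) \<open>exponent F < ereal b\<close> unfolding tendsto_div_real_iff by blast
    then show ?case
    proof eventually_elim
      case (elim n)
      obtain k where k: "yrow n i s = backward_prod UNIV s n i k" by (rule yrow_witness)
      have "backward_prod UNIV s n i k \<le> (if k \<in> F then backward_prod F s n i k else -\<infinity>)"
      proof (rule backward_prod_closed)
        fix n p q assume "p \<in> F" "q \<in> UNIV - F"
        then have "\<not> arc p q" unfolding F_def by (auto dest: rtranclp.rtrancl_into_rtrancl)
        then show "s n p q = -\<infinity>" using \<open>\<forall>n i j. \<not> arc i j \<longrightarrow> s n i j = - \<infinity>\<close> by blast
      qed (use F \<open>no_top s\<close> in auto)
      also have "\<dots> \<le> max_backward F n s" using F(1) by (auto intro: max_entry_ge)
      finally show ?case using elim unfolding k by simp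
    qed
  qed
qed

text \<open>This is the lower bound shared by x and y. One node with a large rate in each component
  suffices, because monotonicity carries the rate backwards along paths.\<close>

lemma top_exponent_le:
  assumes mono: "\<And>i j. arc i j \<Longrightarrow> L j \<le> L i"
    and comp: "\<And>c. c \<in> components \<Longrightarrow> \<exists>i\<in>c. exponent c \<le> L i"
  shows "top_exponent i \<le> L i"
proof -
  obtain c j where c: "c \<in> components" "j \<in> c" "arc\<^sup>*\<^sup>* i j" "top_exponent i = exponent c"
    by (rule top_exponent_witness)
  obtain k where k: "k \<in> c" "exponent c \<le> L k" using comp c(1) by blast
  have "arc\<^sup>*\<^sup>* j k" using c(1,2) k(1) by (auto simp: components_def)
  with c(3) have "arc\<^sup>*\<^sup>* i k" by (rule rtranclp_trans)
  then have "L k \<le> L i" by (induction rule: rtranclp_induct) (auto intro: order_trans mono)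
  with k c show ?thesis by simp
qed

section \<open>Deterministic limits of y\<close>

lemma yrow_no_top: "no_top s \<Longrightarrow> yrow n i s \<noteq> \<infinity>"
  by (rule yrow_witness[of n i s]) (simp add: backward_prod_no_top)

text \<open>Where the first arc from \<open>i\<close> to \<open>j\<close> is finite, it turns paths
  from \<open>j\<close> on the retreated trajectory into paths from \<open>i\<close>. Determinism of
  the limit is what allows comparing rates on two different trajectories.\<close>

lemma yrow_limit_mono:
  assumes lim: "AE s in P. \<forall>i. (\<lambda>n. yrow n i s / ereal (real n)) \<longlonglongrightarrow> L i" and arc: "arc i j"
  shows "L j \<le> L i"
proof (rule ccontr)
  assume *: "\<not> L j \<le> L i"
  have "AE s in P. s (-1) i j = -\<infinity>"
    using lim bwd.AE_iter[OF lim] AE_no_top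
  proof eventually_elim
    case (elim s)
    show ?case
    proof (rule ccontr)
      assume "s (-1) i j \<noteq> -\<infinity>"
      then obtain r where r: "s (-1) i j = ereal r"
        using elim(3) unfolding no_top_def by (metis ereal_cases)
      have freq: "\<exists>\<^sub>F n in sequentially. ereal r + yrow n j (retreat s) \<le> yrow (Suc n) i s"
        using yrow_Suc_ge[OF elim(3), of i j] unfolding r by simp
      have lim_i: "(\<lambda>n. yrow n i s / ereal (real n)) \<longlonglongrightarrow> L i" using elim(1) by blast
      have lim_j: "(\<lambda>n. yrow n j (retreat s) / ereal (real n)) \<longlonglongrightarrow> L j"
        using elim(2)[rule_format, of j 1] by simp
      from limit_le_of_frequently[OF lim_i lim_j freq] * show False by simp
    qed
  qed
  \<comment> \<open>The argument concerns the matrix at time -1; stationarity moves it to time 0,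
    where arcs are defined.\<close>
  from fwd.AE_iter[OF this] have "AE s in P. s 0 i j = -\<infinity>"
    by eventually_elim (drule spec[of _ 1], simp add: advance_def)
  with arc show False by (simp add: arc_iff_not_AE)
qed

lemma yrow_limit_component:
  assumes lim: "AE s in P. \<forall>i. (\<lambda>n. yrow n i s / ereal (real n)) \<longlonglongrightarrow> L i" and c: "c \<in> components"
  shows "\<exists>i\<in>c. exponent c \<le> L i"
proof -
  have ne: "c \<noteq> {}" using c by (auto simp: components_def)
  have "AE s in P. \<exists>i\<in>c. exponent c \<le> L i"
    using lim backward_kingman(2)[OF ne]
  proof eventually_elim
    case (elim s)
    show ?case
    proof (rule limit_le_of_finite_max[where k=0 and r=0, OF finite ne elim(2)])
      show "\<exists>i\<in>c. max_backward c (n + 0) s \<le> ereal 0 + yrow n i s" for n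
      proof -
        obtain i j where ij: "i \<in> c" "j \<in> c" "max_backward c n s = backward_prod c s n i j"
          using max_entry_witness[OF finite ne] by metis
        have "backward_prod c s n i j \<le> backward_prod UNIV s n i j"
          using ij by (intro backward_prod_mono) auto
        also have "\<dots> \<le> yrow n i s" by (rule yrow_ge)
        finally show ?thesis using ij by (auto simp: zero_ereal_def[symmetric])
      qed
    qed (use elim(1) in blast)
  qed
  then show ?thesis by simp
qed

lemma yrow_limit_eq:
  assumes lim: "AE s in P. \<forall>i. (\<lambda>n. yrow n i s / ereal (real n)) \<longlonglongrightarrow> L i"
  shows "L i = top_exponent i"
proof (rule antisym)
  show "top_exponent i \<le> L i"
    using yrow_limit_mono[OF lim] yrow_limit_component[OF lim] by (rule top_exponent_le)
  show "L i \<le> top_exponent i"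
  proof (rule ccontr)
    assume "\<not> ?thesis"
    then have "top_exponent i < L i" by simp
    then obtain b where b: "top_exponent i < ereal b" "ereal b < L i" by (rule ereal_dense2[THEN exE]) blast
    have "AE s in P. (\<lambda>n. yrow n i s / ereal (real n)) \<longlonglongrightarrow> L i"
      using lim by eventually_elim blast
    with yrow_upper[OF b(1)] have "L i \<le> ereal b" by (rule limit_le_eventual_bound)
    with b(2) show False by simp
  qed
qed

section \<open>Rows of the dominant submatrix\<close>

definition dominant :: "'d set \<Rightarrow> 'd set" where
  "dominant c = {i. \<exists>c'\<in>components. (\<exists>j\<in>c. arc\<^sup>*\<^sup>* j i) \<and> (\<exists>j\<in>c'. arc\<^sup>*\<^sup>* i j) \<and>
     exponent c' = Max (exponent ` {b \<in> components. \<exists>i\<in>c. \<exists>j\<in>b. arc\<^sup>*\<^sup>* i j})}"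

text \<open>Among the nodes reachable from \<open>c\<close>, those in the dominant set are exactly
  the ones whose rate is maximal, so membership can be tested on limits.\<close>

lemma dominant_iff:
  assumes "j \<in> c" "arc\<^sup>*\<^sup>* j i"
  shows "i \<in> dominant c \<longleftrightarrow> top_exponent i = Max (exponent ` {b \<in> components. \<exists>i\<in>c. \<exists>j\<in>b. arc\<^sup>*\<^sup>* i j})"
    and "top_exponent i \<le> Max (exponent ` {b \<in> components. \<exists>i\<in>c. \<exists>j\<in>b. arc\<^sup>*\<^sup>* i j})"
proof -
  let ?g = "Max (exponent ` {b \<in> components. \<exists>i\<in>c. \<exists>j\<in>b. arc\<^sup>*\<^sup>* i j})"
  obtain c' k where c': "c' \<in> components" "k \<in> c'" "arc\<^sup>*\<^sup>* i k" "top_exponent i = exponent c'"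
    by (rule top_exponent_witness)
  have "arc\<^sup>*\<^sup>* j k" using assms(2) c'(3) by (rule rtranclp_trans)
  then have "exponent c' \<le> ?g" using c' assms(1) by (intro Max_ge) auto
  then show le: "top_exponent i \<le> ?g" using c' by simp
  show "i \<in> dominant c \<longleftrightarrow> top_exponent i = ?g"
  proof
    assume "i \<in> dominant c"
    then obtain b l where "b \<in> components" "l \<in> b" "arc\<^sup>*\<^sup>* i l" "exponent b = ?g"
      unfolding dominant_def by blast
    then have "?g \<le> top_exponent i" using top_exponent_ge by metis
    with le show "top_exponent i = ?g" by (rule antisym)
  next
    assume "top_exponent i = ?g"
    then show "i \<in> dominant c" unfolding dominant_def using c' assms by auto
  qed
qed

text \<open>y_i is the maximum over the finite entries \<open>j\<close> of its first row of that
  entry plus y_j one step earlier. Some such \<open>j\<close> therefore has a rate no smaller than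
  that of \<open>i\<close>; if \<open>i\<close> is maximal, so is \<open>j\<close>.\<close>

lemma dominant_rows_finite:
  assumes lim: "AE s in P. \<forall>i. (\<lambda>n. yrow n i s / ereal (real n)) \<longlonglongrightarrow> L i"
    and rows: "AE s in P. \<forall>i. \<exists>j. s 0 i j \<noteq> -\<infinity>"
  shows "AE s in P. \<forall>i\<in>dominant c. \<exists>j\<in>dominant c. s 0 i j \<noteq> -\<infinity>"
proof -
  let ?g = "Max (exponent ` {b \<in> components. \<exists>i\<in>c. \<exists>j\<in>b. arc\<^sup>*\<^sup>* i j})"
  have "AE s in P. \<forall>i\<in>dominant c. \<exists>j\<in>dominant c. s (-1) i j \<noteq> -\<infinity>"
    using lim bwd.AE_iter[OF lim] AE_no_top AE_no_arc AE_all_times[OF rows]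
  proof eventually_elim
    case (elim s)
    show ?case
    proof
      fix i assume i: "i \<in> dominant c"
      then obtain k where k: "k \<in> c" "arc\<^sup>*\<^sup>* k i" unfolding dominant_def by blast
      define J where "J = {j. s (-1) i j \<noteq> -\<infinity>}"
      have J: "finite J" "J \<noteq> {}" using elim(5) by (auto simp: J_def)
      define r where "r = peak (retreat s)"
      have r: "s (-1) i j \<le> ereal r" for j
        using entry_le_peak_retreat[OF elim(3), of 0 i j] by (simp add: r_def)
      have "\<exists>j\<in>J. L i \<le> L j"
      proof (rule limit_le_of_finite_max[where k=1 and r=r, OF J])
        show "(\<lambda>n. yrow n i s / ereal (real n)) \<longlonglongrightarrow> L i" using elim(1) by blast
        show "(\<lambda>n. yrow n j (retreat s) / ereal (real n)) \<longlonglongrightarrow> L j" for j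
          using elim(2)[rule_format, of j 1] by simp
        show "\<exists>j\<in>J. yrow (n + 1) i s \<le> ereal r + yrow n j (retreat s)" for n
        proof -
          obtain l where l: "yrow (Suc n) i s = s (-1) i l + yrow n l (retreat s)"
            using yrow_Suc_witness[OF elim(3)] .
          show ?thesis
          proof (cases "l \<in> J")
            case True
            then show ?thesis using l add_right_mono[OF r[of l]] by auto
          next
            case False
            \<comment> \<open>An index outside \<open>J\<close> can attain the maximum only if the
              whole row sum is -\<infinity>, and then any element of \<open>J\<close>
              serves.\<close>
            then have "yrow (Suc n) i s = -\<infinity>"
              using yrow_no_top[OF no_top_step(2)[OF elim(3)], of n l] unfolding l J_def by simp
            then show ?thesis using J(2) by auto
          qed
        qed
      qed
      then obtain j where j: "j \<in> J" "L i \<le> L j" by blast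
      have "arc i j" using j(1) elim(4) unfolding J_def by blast
      with k(2) have kj: "arc\<^sup>*\<^sup>* k j" by (rule rtranclp.rtrancl_into_rtrancl)
      have "?g \<le> top_exponent j"
        using dominant_iff(1)[OF k] i j(2) unfolding yrow_limit_eq[OF lim] by simp
      then have "j \<in> dominant c"
        using dominant_iff[OF k(1) kj] by (simp add: antisym)
      then show "\<exists>j\<in>dominant c. s (-1) i j \<noteq> -\<infinity>" using j(1) unfolding J_def by blast
    qed
  qed
  from fwd.AE_iter[OF this] show ?thesis
    by eventually_elim (drule spec[of _ 1], simp add: advance_def)
qed

text \<open>Stated for every possible limit \<open>l\<close>, so a limit depending on the trajectory
  is covered without choosing it measurably. A limit above the drift would keep a rational slope
  that almost no trajectory has.\<close>

lemma xrow_limit: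
  "AE s in P. \<forall>(i :: 'd) l. ((\<lambda>n. xrow n i s / ereal (real n)) \<longlonglongrightarrow> l) \<longrightarrow> l = fwd.drift (\<lambda>n. xrow n i)"
proof (subst AE_all_countable, intro allI)
  fix i :: 'd
  let ?d = "fwd.drift (\<lambda>n. xrow n i)"
  have meas: "xrow n i \<in> borel_measurable P" for n by measurable
  have sub: "AE s in P. \<forall>n. xrow (Suc n) i s \<le> ereal (peak s) + xrow n i (advance s)"
    using AE_no_top
  proof eventually_elim
    case (elim s)
    show ?case
    proof
      fix n
      have "xrow (1 + n) i s \<le> max_forward UNIV 1 s + xrow n i ((advance ^^ 1) s)" by (rule xrow_split)
      also have "\<dots> \<le> ereal (peak s) + xrow n i ((advance ^^ 1) s)"
        by (intro add_right_mono max_forward_one_le_peak elim UNIV_not_empty)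
      finally show "xrow (Suc n) i s \<le> ereal (peak s) + xrow n i (advance s)" by simp
    qed
  qed
  have "AE s in P. \<forall>q::rat. ereal (of_rat q) < ?d \<longrightarrow> (\<forall>\<^sub>F n in sequentially. ereal (of_rat q * real n) \<le> xrow n i s)"
    using fwd.AE_ge_below_drift[of "\<lambda>n. xrow n i", OF meas] by (auto simp: AE_all_countable)
  moreover have "AE s in P. \<forall>q::rat. ?d < ereal (of_rat q) \<longrightarrow> s \<notin> fwd.drift_set (\<lambda>n. xrow n i) (of_rat q)"
    using fwd.drift_set_null_above_drift[of "\<lambda>n. xrow n i", OF meas sub] by (auto simp: AE_all_countable)
  ultimately show "AE s in P. \<forall>l. ((\<lambda>n. xrow n i s / ereal (real n)) \<longlonglongrightarrow> l) \<longrightarrow> l = ?d"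
  proof eventually_elim
    case (elim s)
    show ?case
    proof (intro allI impI)
      fix l assume l: "(\<lambda>n. xrow n i s / ereal (real n)) \<longlonglongrightarrow> l"
      show "l = ?d"
      proof (rule antisym)
        show "l \<le> ?d"
        proof (rule ccontr)
          assume "\<not> l \<le> ?d"
          then have "?d < l" by simp
          then obtain q :: rat where q: "?d < ereal (of_rat q)" "ereal (of_rat q) < l"
            by (rule ereal_dense3[THEN exE]) blast
          from q(2) obtain c where c: "ereal (of_rat q) < ereal c" "ereal c < l"
            by (rule ereal_dense2[THEN exE]) blast
          have "\<forall>\<^sub>F n in sequentially. ereal (c * real n) \<le> xrow n i s"
            using l c(2) unfolding tendsto_div_real_iff by blast
          then have "s \<in> fwd.drift_set (\<lambda>n. xrow n i) (of_rat q)"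
            using c(1) unfolding fwd.drift_set_iff by auto
          with elim(2) q(1) show False by blast
        qed
        show "?d \<le> l"
        proof (rule ccontr)
          assume "\<not> ?d \<le> l"
          then have "l < ?d" by simp
          then obtain q :: rat where q: "l < ereal (of_rat q)" "ereal (of_rat q) < ?d"
            by (rule ereal_dense3[THEN exE]) blast
          have "\<forall>\<^sub>F n in sequentially. ereal (of_rat q * real n) \<le> xrow n i s"
            using elim(1) q(2) by blast
          then have "\<forall>\<^sub>F n in sequentially. ereal (of_rat q) \<le> xrow n i s / ereal (real n)"
            using eventually_gt_at_top[of 0]
            by eventually_elim (simp add: ereal_le_divide_pos mult.commute)
          then have "ereal (of_rat q) \<le> l" using tendsto_lowerbound[OF l] by simp
          with q(1) show False by simp
        qed
      qed
    qed
  qed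
qed

text \<open>Unlike for y, the trajectory stays fixed and the connecting entry changes with
  \<open>n\<close>, so it could decrease without bound. Some level \<open>- real k\<close> is
  exceeded with positive probability, hence infinitely often, and this is enough to compare the
  limits.\<close>

lemma xrow_limit_mono:
  assumes lim: "AE s in P. \<forall>i. (\<lambda>n. xrow n i s / ereal (real n)) \<longlonglongrightarrow> L i" and arc: "arc i j"
  shows "L j \<le> L i"
proof -
  have [measurable]: "{s. ereal (- real k) \<le> s 0 i j} \<in> sets P" for k :: nat
  proof -
    have "{s \<in> space P. ereal (- real k) \<le> s 0 i j} \<in> sets P" by measurable
    then show ?thesis by simp
  qed
  have "\<exists>k::nat. prob {s. ereal (- real k) \<le> s 0 i j} > 0"
  proof (rule ccontr)
    assume "\<not> ?thesis"
    then have "prob {s. ereal (- real k) \<le> s 0 i j} = 0" for k :: nat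
      using measure_nonneg[of P "{s. ereal (- real k) \<le> s 0 i j}"] by (metis less_eq_real_def)
    then have "AE s in P. s \<notin> {s. ereal (- real k) \<le> s 0 i j}" for k :: nat
      by (subst (asm) prob_eq_0) auto
    then have "AE s in P. \<forall>k::nat. \<not> ereal (- real k) \<le> s 0 i j"
      by (simp add: AE_all_countable)
    then have "AE s in P. s 0 i j = -\<infinity>"
    proof eventually_elim
      case (elim s)
      have "s 0 i j < ereal r" for r
      proof -
        obtain k :: nat where "- r \<le> real k" using real_arch_simple by blast
        then have "ereal (- real k) \<le> ereal r" by simp
        with elim show ?thesis by (meson le_less_linear less_le_trans)
      qed
      then show ?case by (intro ereal_bot less_imp_le)
    qed
    with arc show False by (simp add: arc_iff_not_AE)
  qed
  then obtain k :: nat where "prob {s. ereal (- real k) \<le> s 0 i j} > 0" by blast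
  then have "AE s in P. \<exists>\<^sub>F n in sequentially. (advance ^^ n) s \<in> {s. ereal (- real k) \<le> s 0 i j}"
    by (intro fwd.AE_infinitely_often) measurable
  with lim have "AE s in P. L j \<le> L i"
  proof eventually_elim
    case (elim s)
    have "\<exists>\<^sub>F n in sequentially. ereal (- real k) + xrow n j s \<le> xrow (Suc n) i s"
      using elim(2)
    proof (rule frequently_elim1)
      fix n assume "(advance ^^ n) s \<in> {s. ereal (- real k) \<le> s 0 i j}"
      then have "ereal (- real k) \<le> s (int n) i j" by (simp add: advance_iter)
      then have "ereal (- real k) + xrow n j s \<le> s (int n) i j + xrow n j s" by (rule add_right_mono)
      also have "\<dots> \<le> xrow (Suc n) i s" by (rule xrow_Suc_ge)
      finally show "ereal (- real k) + xrow n j s \<le> xrow (Suc n) i s" .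
    qed
    then show ?case by (rule limit_le_of_frequently[rotated 2]) (use elim(1) in blast)+
  qed
  then show ?thesis by simp
qed

lemma xrow_limit_component:
  assumes lim: "AE s in P. \<forall>i. (\<lambda>n. xrow n i s / ereal (real n)) \<longlonglongrightarrow> L i" and c: "c \<in> components"
  shows "\<exists>i\<in>c. exponent c \<le> L i"
proof -
  have ne: "c \<noteq> {}" using c by (auto simp: components_def)
  have "AE s in P. \<exists>i\<in>c. exponent c \<le> L i"
    using lim forward_kingman[OF ne]
  proof eventually_elim
    case (elim s)
    show ?case
    proof (rule limit_le_of_finite_max[where k=0 and r=0, OF finite ne elim(2)])
      show "\<exists>i\<in>c. max_forward c (n + 0) s \<le> ereal 0 + xrow n i s" for n
      proof -
        obtain i j where ij: "i \<in> c" "j \<in> c" "max_forward c n s = forward_prod c s n i j"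
          using max_entry_witness[OF finite ne] by metis
        have "forward_prod c s n i j \<le> forward_prod UNIV s n i j"
          using ij by (intro forward_prod_mono) auto
        also have "\<dots> \<le> xrow n i s" by (rule xrow_ge)
        finally show ?thesis using ij by (auto simp: zero_ereal_def[symmetric])
      qed
    qed (use elim(1) in blast)
  qed
  then show ?thesis by simp
qed

lemma yrow_lower_of_xrow_limit:
  assumes lim: "AE s in P. \<forall>i. (\<lambda>n. xrow n i s / ereal (real n)) \<longlonglongrightarrow> L i" and c: "ereal c < L i"
  shows "AE s in P. \<forall>\<^sub>F n in sequentially. ereal (c * real n) \<le> yrow n i s"
proof -
  obtain b where b: "ereal c < ereal b" "ereal b < L i" using c by (rule ereal_dense2[THEN exE]) blast
  show ?thesis
  proof (rule bwd.reversed_lower[where f="\<lambda>n. xrow n i" and a="\<lambda>s. peak (retreat s)" and b=b])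
    show "xrow n i \<in> borel_measurable P" for n by measurable
    show "AE s in P. \<forall>\<^sub>F n in sequentially. ereal (b * real n) \<le> xrow n i s"
      using lim
    proof eventually_elim
      case (elim s) then show ?case using b(2) unfolding tendsto_div_real_iff by blast
    qed
    show "AE s in P. \<forall>n. yrow n i s = xrow n i ((retreat ^^ n) s)"
      using AE_no_top by eventually_elim (simp add: yrow_eq_xrow)
    show "AE s in P. \<forall>k l. yrow (k + l) i s \<le> yrow k i s + ereal (\<Sum>j\<in>{k..<k+l}. peak (retreat ((retreat ^^ j) s)))"
      using AE_no_top
    proof eventually_elim
      case (elim s)
      show ?case
      proof (intro allI)
        fix k l
        have "yrow (k + l) i s \<le> yrow k i s + max_backward UNIV l ((retreat ^^ k) s)"
          by (rule yrow_split)
        also have "\<dots> \<le> yrow k i s + ereal (\<Sum>j<l. peak (retreat ((retreat ^^ j) ((retreat ^^ k) s))))"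
          by (intro add_left_mono max_backward_le_peak no_top_iter elim UNIV_not_empty)
        finally show "yrow (k + l) i s \<le> yrow k i s + ereal (\<Sum>j\<in>{k..<k+l}. peak (retreat ((retreat ^^ j) s)))"
          unfolding sum_orbit_shift[of "\<lambda>s. peak (retreat s)"] .
      qed
    qed
    show "c < b" using b(1) by simp
  qed (rule integrable_peak_retreat peak_nonneg)+
qed

text \<open>The upper bound for x is obtained through y: every slope below \<open>L i\<close> is
  also a lower slope of y_i, whose growth is bounded by \<open>top_exponent i\<close>.\<close>

lemma xrow_limit_eq:
  assumes lim: "AE s in P. \<forall>i. (\<lambda>n. xrow n i s / ereal (real n)) \<longlonglongrightarrow> L i"
  shows "L i = top_exponent i" "AE s in P. (\<lambda>n. yrow n i s / ereal (real n)) \<longlonglongrightarrow> top_exponent i"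
proof -
  have ge: "top_exponent i \<le> L i"
    using xrow_limit_mono[OF lim] xrow_limit_component[OF lim] by (rule top_exponent_le)
  show y: "AE s in P. (\<lambda>n. yrow n i s / ereal (real n)) \<longlonglongrightarrow> top_exponent i"
  proof (rule AE_tendsto_div_realI)
    show "AE s in P. \<forall>\<^sub>F n in sequentially. ereal (b * real n) \<le> yrow n i s" if "ereal b < top_exponent i" for b
      using that ge by (intro yrow_lower_of_xrow_limit[OF lim]) (rule less_le_trans)
  qed (rule yrow_upper)
  show "L i = top_exponent i"
  proof (rule antisym[OF _ ge], rule ccontr)
    assume "\<not> L i \<le> top_exponent i"
    then have "top_exponent i < L i" by simp
    then obtain c where c: "top_exponent i < ereal c" "ereal c < L i" by (rule ereal_dense2[THEN exE]) blast
    have "ereal c \<le> top_exponent i"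
      using yrow_lower_of_xrow_limit[OF lim c(2)] y by (rule limit_ge_eventual_bound)
    with c(1) show False by simp
  qed
qed

end

section \<open>Transfer to the probability space of the sequence\<close>

text \<open>Passing an almost sure limit from the given space to the law of the sequence requires
  the event to be measurable.\<close>

lemma tendsto_set_measurable:
  fixes u :: "nat \<Rightarrow> 'a \<Rightarrow> ereal"
  assumes [measurable]: "\<And>n. u n \<in> borel_measurable M"
  shows "{x \<in> space M. (\<lambda>n. u n x) \<longlonglongrightarrow> g} \<in> sets M"
proof -
  have "{x \<in> space M. liminf (\<lambda>n. u n x) = g \<and> limsup (\<lambda>n. u n x) = g} \<in> sets M" by measurable
  then show ?thesis by (simp add: tendsto_iff_Liminf_eq_Limsup)
qed

text \<open>Reachability in the graph library is a closure restricted to the vertices; here every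
  index is a vertex, so it is the plain reflexive transitive closure.\<close>

lemma reachable_mp_graph:
  "reachable (mp_graph M A) i j \<longleftrightarrow>
     (\<lambda>i j. measure M {\<omega> \<in> space M. A 0 \<omega> i j \<noteq> -\<infinity>} > 0)\<^sup>*\<^sup>* i j"
proof -
  have ends: "arcs_ends (mp_graph M A) = {(i, j). measure M {\<omega> \<in> space M. A 0 \<omega> i j \<noteq> -\<infinity>} > 0}"
    by (auto simp: arcs_ends_def arc_to_ends_def mp_graph_def)
  have "reachable (mp_graph M A) i j \<longleftrightarrow> (i, j) \<in> (arcs_ends (mp_graph M A))\<^sup>*"
  proof
    assume "reachable (mp_graph M A) i j"
    then show "(i, j) \<in> (arcs_ends (mp_graph M A))\<^sup>*"
      unfolding reachable_def by (rule rtrancl_on_rtranclI)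
  next
    assume "(i, j) \<in> (arcs_ends (mp_graph M A))\<^sup>*"
    then show "reachable (mp_graph M A) i j"
      unfolding reachable_def by (intro rtrancl_consistent_rtrancl_on) (auto simp: mp_graph_def)
  qed
  then show ?thesis unfolding ends by (simp add: rtranclp_rtrancl_eq)
qed

context
  fixes M :: "'w measure" and A :: "int \<Rightarrow> 'w \<Rightarrow> 'd::finite \<Rightarrow> 'd \<Rightarrow> ereal"
  assumes prob: "prob_space M"
    and stationary: "stationary M A"
    and ergodic: "ergodic M A"
    and finite_above: "\<And>n \<omega> i j. \<omega> \<in> space M \<Longrightarrow> A n \<omega> i j \<noteq> \<infinity>"
    and integrable: "integrable M (\<lambda>\<omega>. real_of_ereal (max 0 (max_entry UNIV (A 0 \<omega>))))"
begin

definition trajectory :: "'w \<Rightarrow> int \<Rightarrow> 'd mp_mat" where "trajectory \<omega> = (\<lambda>n. A n \<omega>)"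

text \<open>The given probability space need not carry a shift; on trajectories it is a map,
  invertible and measure preserving.\<close>

definition law :: "(int \<Rightarrow> 'd mp_mat) measure" where "law = distr M path_space trajectory"

lemma trajectory_measurable: "trajectory \<in> measurable M path_space"
  using stationary unfolding stationary_def trajectory_def[abs_def]
  by (intro measurable_PiM_single') (auto simp: space_PiM)

lemma AE_law_iff:
  assumes "{s \<in> space path_space. Q s} \<in> sets path_space"
  shows "(AE s in law. Q s) \<longleftrightarrow> (AE \<omega> in M. Q (trajectory \<omega>))"
  unfolding law_def by (rule AE_distr_iff[OF trajectory_measurable assms])

lemma AE_trajectoryI: "(AE s in law. Q s) \<Longrightarrow> AE \<omega> in M. Q (trajectory \<omega>)"
  unfolding law_def by (rule AE_distrD[OF trajectory_measurable])

lemma measure_law: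
  "B \<in> sets path_space \<Longrightarrow> measure law B = measure M {\<omega> \<in> space M. trajectory \<omega> \<in> B}"
  unfolding law_def by (subst measure_distr[OF trajectory_measurable]) (auto intro: arg_cong[where f="measure M"])

lemma law_mp_system: "mp_system law"
proof -
  interpret M: prob_space M by (rule prob)
  interpret law: prob_space law unfolding law_def by (rule M.prob_space_distr[OF trajectory_measurable])
  have sets_law [simp]: "sets law = sets path_space" by (simp add: law_def)
  have top: "{s \<in> space path_space. no_top s} \<in> sets (path_space :: (int \<Rightarrow> 'd mp_mat) measure)"
    unfolding no_top_def by measurable
  show ?thesis
  proof unfold_locales
    show "distr law law advance = law"
    proof -
      have "distr law law advance = distr law path_space advance"
        by (rule distr_cong) auto
      also have "\<dots> = distr M path_space (advance \<circ> trajectory)"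
        unfolding law_def by (rule distr_distr[OF advance_measurable trajectory_measurable])
      also have "\<dots> = distr M path_space (\<lambda>\<omega> n. A (n + 1) \<omega>)"
        by (simp add: comp_def advance_def trajectory_def)
      also have "\<dots> = law" using stationary unfolding stationary_def law_def trajectory_def[abs_def] by blast
      finally show ?thesis .
    qed
    show "law.prob B \<in> {0, 1}" if "B \<in> sets path_space" "advance -` B = B" for B
      using ergodic that unfolding ergodic_def measure_law[OF that(1)] advance_def[abs_def] trajectory_def by blast
    show "AE s in law. no_top s"
      unfolding AE_law_iff[OF top] using finite_above by (auto simp: no_top_def trajectory_def)
    show "integrable law (\<lambda>s. real_of_ereal (max 0 (max_entry UNIV (s 0))))"
      unfolding law_def using integrable
      by (subst integrable_distr_eq[OF trajectory_measurable]) (auto simp: trajectory_def)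
  qed simp
qed

interpretation law: mp_system law by (rule law_mp_system)

text \<open>This validates the definite description: Kingman's theorem for both products gives
  existence, and two almost sure limits must agree.\<close>

lemma lyapunov_eq_exponent:
  assumes "S \<noteq> {}" shows "lyapunov M A S = law.exponent S"
  unfolding lyapunov_def
proof (rule the_equality)
  interpret M: prob_space M by (rule prob)
  have fwd: "AE \<omega> in M. (\<lambda>n. max_entry S (forward_prod S (\<lambda>k. A k \<omega>) n) / ereal (real n)) \<longlonglongrightarrow> law.exponent S"
    using AE_trajectoryI[OF law.forward_kingman[OF assms]] unfolding trajectory_def .
  show "has_lyapunov M S A (law.exponent S)"
    using AE_trajectoryI[OF law.backward_kingman(2)[OF assms]] fwd law.backward_kingman(1)[OF assms]
    unfolding has_lyapunov_def trajectory_def by blast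
  fix g assume "has_lyapunov M S A g"
  then have "AE \<omega> in M. (\<lambda>n. max_entry S (forward_prod S (\<lambda>k. A k \<omega>) n) / ereal (real n)) \<longlonglongrightarrow> g"
    unfolding has_lyapunov_def by blast
  with fwd have "AE \<omega> in M. g = law.exponent S"
    by eventually_elim (rule LIMSEQ_unique)
  then show "g = law.exponent S" by simp
qed

lemma reachable_iff: "reachable (mp_graph M A) i j \<longleftrightarrow> law.arc\<^sup>*\<^sup>* i j"
proof -
  have "measure M {\<omega> \<in> space M. A 0 \<omega> i j \<noteq> -\<infinity>} > 0 \<longleftrightarrow> law.arc i j" for i j
  proof -
    have "{s \<in> space path_space. s 0 i j \<noteq> -\<infinity>} \<in> sets (path_space :: (int \<Rightarrow> 'd mp_mat) measure)"
      by measurable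
    then show ?thesis unfolding law.arc_def by (subst measure_law) (auto simp: space_PiM trajectory_def)
  qed
  then show ?thesis unfolding reachable_mp_graph by presburger
qed

lemma comps_eq: "comps M A = law.components"
  unfolding pre_digraph.sccs_verts_def law.components_def reachable_iff ..

lemma max_exponent_eq: "max_exponent M A i = law.top_exponent i"
  unfolding max_exponent_def law.top_exponent_def node_to_comp_def comps_eq reachable_iff
  by (intro arg_cong[where f=Max] image_cong refl lyapunov_eq_exponent) (auto simp: law.components_def)

lemma dominant_nodes_eq: "dominant_nodes M A c = law.dominant c"
proof -
  have "lyapunov M A ` {b \<in> law.components. \<exists>i\<in>c. \<exists>j\<in>b. law.arc\<^sup>*\<^sup>* i j}
      = law.exponent ` {b \<in> law.components. \<exists>i\<in>c. \<exists>j\<in>b. law.arc\<^sup>*\<^sup>* i j}"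
    by (intro image_cong refl lyapunov_eq_exponent) (auto simp: law.components_def)
  moreover have "lyapunov M A c' = law.exponent c'" if "c' \<in> law.components" for c'
    using that by (intro lyapunov_eq_exponent) (auto simp: law.components_def)
  ultimately show ?thesis
    unfolding dominant_nodes_def law.dominant_def comps_eq comp_to_node_def node_to_comp_def
      comp_to_comp_def reachable_iff by auto
qed

lemma y_vec_eq: "y_vec A (\<lambda>_. 0) n \<omega> i = yrow n i (trajectory \<omega>)"
  by (simp add: y_vec_def yrow_def trajectory_def)

lemma x_vec_eq: "x_vec A (\<lambda>_. 0) n \<omega> i = xrow n i (trajectory \<omega>)"
  by (simp add: x_vec_def xrow_def trajectory_def)

lemma AE_law_limitI:
  fixes u :: "'d \<Rightarrow> nat \<Rightarrow> (int \<Rightarrow> 'd mp_mat) \<Rightarrow> ereal"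
  assumes [measurable]: "\<And>i n. u i n \<in> borel_measurable path_space"
    and lim: "AE \<omega> in M. \<forall>i. (\<lambda>n. u i n (trajectory \<omega>) / ereal (real n)) \<longlonglongrightarrow> L i"
  shows "AE s in law. \<forall>i. (\<lambda>n. u i n s / ereal (real n)) \<longlonglongrightarrow> L i"
proof (subst AE_all_countable, intro allI)
  fix i
  have "{s \<in> space path_space. (\<lambda>n. u i n s / ereal (real n)) \<longlonglongrightarrow> L i} \<in> sets path_space"
    by (intro tendsto_set_measurable) measurable
  from AE_law_iff[OF this] show "AE s in law. (\<lambda>n. u i n s / ereal (real n)) \<longlonglongrightarrow> L i"
    using lim by (auto elim: AE_mp)
qed

lemma backward_limit:
  assumes "AE \<omega> in M. \<forall>i. (\<lambda>n. y_vec A (\<lambda>_. 0) n \<omega> i / ereal (real n)) \<longlonglongrightarrow> L i"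
    and rows: "AE \<omega> in M. \<forall>i. \<exists>j. A 0 \<omega> i j \<noteq> -\<infinity>"
  shows "AE \<omega> in M. (\<lambda>n. y_vec A (\<lambda>_. 0) n \<omega> i / ereal (real n)) \<longlonglongrightarrow> max_exponent M A i"
    and "AE \<omega> in M. \<forall>i \<in> dominant_nodes M A c. \<exists>j \<in> dominant_nodes M A c. A 0 \<omega> i j \<noteq> -\<infinity>"
proof -
  have lim: "AE s in law. \<forall>i. (\<lambda>n. yrow n i s / ereal (real n)) \<longlonglongrightarrow> L i"
    using assms(1) unfolding y_vec_eq by (intro AE_law_limitI) auto
  have "AE \<omega> in M. (\<lambda>n. y_vec A (\<lambda>_. 0) n \<omega> i / ereal (real n)) \<longlonglongrightarrow> L i"
    using assms(1) by eventually_elim blast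
  then show "AE \<omega> in M. (\<lambda>n. y_vec A (\<lambda>_. 0) n \<omega> i / ereal (real n)) \<longlonglongrightarrow> max_exponent M A i"
    unfolding max_exponent_eq law.yrow_limit_eq[OF lim] .
  have "{s \<in> space path_space. \<forall>i. \<exists>j. s 0 i j \<noteq> -\<infinity>} \<in> sets (path_space :: (int \<Rightarrow> 'd mp_mat) measure)"
    by measurable
  from AE_law_iff[OF this] have "AE s in law. \<forall>i. \<exists>j. s 0 i j \<noteq> -\<infinity>" using rows by (simp add: trajectory_def)
  from AE_trajectoryI[OF law.dominant_rows_finite[OF lim this]]
  show "AE \<omega> in M. \<forall>i \<in> dominant_nodes M A c. \<exists>j \<in> dominant_nodes M A c. A 0 \<omega> i j \<noteq> -\<infinity>"
    unfolding dominant_nodes_eq trajectory_def .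
qed

lemma forward_limit:
  assumes "AE \<omega> in M. \<exists>L. \<forall>i. (\<lambda>n. x_vec A (\<lambda>_. 0) n \<omega> i / ereal (real n)) \<longlonglongrightarrow> L i"
  shows "AE \<omega> in M. (\<lambda>n. x_vec A (\<lambda>_. 0) n \<omega> i / ereal (real n)) \<longlonglongrightarrow> max_exponent M A i"
    and "AE \<omega> in M. (\<lambda>n. y_vec A (\<lambda>_. 0) n \<omega> i / ereal (real n)) \<longlonglongrightarrow> max_exponent M A i"
proof -
  \<comment> \<open>The hypothesis offers a limit that may depend on the outcome; ergodicity
    identifies it almost surely with this deterministic drift.\<close>
  define L where "L i = law.fwd.drift (\<lambda>n. xrow n i)" for i
  have M: "AE \<omega> in M. \<forall>i. (\<lambda>n. xrow n i (trajectory \<omega>) / ereal (real n)) \<longlonglongrightarrow> L i"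
    using assms AE_trajectoryI[OF law.xrow_limit]
  proof eventually_elim
    case (elim \<omega>)
    then obtain l where l: "\<And>i. (\<lambda>n. xrow n i (trajectory \<omega>) / ereal (real n)) \<longlonglongrightarrow> l i"
      unfolding x_vec_eq by blast
    with elim(2) have "l i = L i" for i unfolding L_def by blast
    with l show ?case by metis
  qed
  then have lim: "AE s in law. \<forall>i. (\<lambda>n. xrow n i s / ereal (real n)) \<longlonglongrightarrow> L i"
    by (intro AE_law_limitI) auto
  show "AE \<omega> in M. (\<lambda>n. x_vec A (\<lambda>_. 0) n \<omega> i / ereal (real n)) \<longlonglongrightarrow> max_exponent M A i"
    using M unfolding x_vec_eq max_exponent_eq law.xrow_limit_eq(1)[OF lim, symmetric]
    by eventually_elim blast
  show "AE \<omega> in M. (\<lambda>n. y_vec A (\<lambda>_. 0) n \<omega> i / ereal (real n)) \<longlonglongrightarrow> max_exponent M A i"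
    using AE_trajectoryI[OF law.xrow_limit_eq(2)[OF lim]] unfolding y_vec_eq max_exponent_eq .
qed

end

theorem theorem2p3:
  fixes M :: "'w measure" and A :: "int \<Rightarrow> 'w \<Rightarrow> 'd::finite \<Rightarrow> 'd \<Rightarrow> ereal"
  assumes "prob_space M"
    and "stationary M A"
    and "ergodic M A"
    and "\<And>n \<omega> i j. \<omega> \<in> space M \<Longrightarrow> A n \<omega> i j \<noteq> \<infinity>"
    and "AE \<omega> in M. \<forall>i. \<exists>j. A 0 \<omega> i j \<noteq> -\<infinity>"
    and "integrable M (\<lambda>\<omega>. real_of_ereal (max 0 (max_entry UNIV (A 0 \<omega>))))"
  shows
    "((\<exists>L :: 'd \<Rightarrow> ereal. (\<forall>i. L i \<noteq> \<infinity>) \<and>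
         (AE \<omega> in M. \<forall>i. (\<lambda>n. y_vec A (\<lambda>_. 0) n \<omega> i / ereal (real n)) \<longlonglongrightarrow> L i)) \<longrightarrow>
       (\<forall>i. AE \<omega> in M.
          (\<lambda>n. y_vec A (\<lambda>_. 0) n \<omega> i / ereal (real n)) \<longlonglongrightarrow> max_exponent M A i) \<and>
       (\<forall>c \<in> comps M A. AE \<omega> in M.
          \<forall>i \<in> dominant_nodes M A c. \<exists>j \<in> dominant_nodes M A c. A 0 \<omega> i j \<noteq> -\<infinity>)) \<and>
     ((AE \<omega> in M. \<exists>L :: 'd \<Rightarrow> ereal. (\<forall>i. L i \<noteq> \<infinity>) \<and>
         (\<forall>i. (\<lambda>n. x_vec A (\<lambda>_. 0) n \<omega> i / ereal (real n)) \<longlonglongrightarrow> L i)) \<longrightarrow>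
       (\<forall>i. AE \<omega> in M.
          (\<lambda>n. x_vec A (\<lambda>_. 0) n \<omega> i / ereal (real n)) \<longlonglongrightarrow> max_exponent M A i) \<and>
       (\<forall>i. AE \<omega> in M.
          (\<lambda>n. y_vec A (\<lambda>_. 0) n \<omega> i / ereal (real n)) \<longlonglongrightarrow> max_exponent M A i))"
proof (intro conjI impI)
  note A = assms(1-4,6)
  {
    assume "\<exists>L :: 'd \<Rightarrow> ereal. (\<forall>i. L i \<noteq> \<infinity>) \<and>
      (AE \<omega> in M. \<forall>i. (\<lambda>n. y_vec A (\<lambda>_. 0) n \<omega> i / ereal (real n)) \<longlonglongrightarrow> L i)"
    then obtain L :: "'d \<Rightarrow> ereal" where
      L: "AE \<omega> in M. \<forall>i. (\<lambda>n. y_vec A (\<lambda>_. 0) n \<omega> i / ereal (real n)) \<longlonglongrightarrow> L i" by blast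
    show "\<forall>i. AE \<omega> in M. (\<lambda>n. y_vec A (\<lambda>_. 0) n \<omega> i / ereal (real n)) \<longlonglongrightarrow> max_exponent M A i"
      using backward_limit(1)[OF A L assms(5)] by blast
    show "\<forall>c \<in> comps M A. AE \<omega> in M.
        \<forall>i \<in> dominant_nodes M A c. \<exists>j \<in> dominant_nodes M A c. A 0 \<omega> i j \<noteq> -\<infinity>"
      using backward_limit(2)[OF A L assms(5)] by blast
  next
    assume "AE \<omega> in M. \<exists>L :: 'd \<Rightarrow> ereal. (\<forall>i. L i \<noteq> \<infinity>) \<and>
      (\<forall>i. (\<lambda>n. x_vec A (\<lambda>_. 0) n \<omega> i / ereal (real n)) \<longlonglongrightarrow> L i)"
    then have L: "AE \<omega> in M. \<exists>L. \<forall>i. (\<lambda>n. x_vec A (\<lambda>_. 0) n \<omega> i / ereal (real n)) \<longlonglongrightarrow> L i"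
      by eventually_elim blast
    show "\<forall>i. AE \<omega> in M. (\<lambda>n. x_vec A (\<lambda>_. 0) n \<omega> i / ereal (real n)) \<longlonglongrightarrow> max_exponent M A i"
      using forward_limit(1)[OF A L] by blast
    show "\<forall>i. AE \<omega> in M. (\<lambda>n. y_vec A (\<lambda>_. 0) n \<omega> i / ereal (real n)) \<longlonglongrightarrow> max_exponent M A i"
      using forward_limit(2)[OF A L] by blast
  }
qed

end
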